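(* Let $\theta\in\mathbb{R}^3$, let $\Gamma$ be a symmetric positive definite $3\times 3$ matrix, let $R$ be a completely-$\mathcal{S}$ $3\times 3$ matrix with $R_{11}=R_{22}=R_{33}=1$, and let $Z$ be a semimartingale reflecting Brownian motion in $\mathbb{R}^3_+$ with data $(\theta,\Gamma,R)$. If $(\theta,R)\in C$ and $\beta(\theta,R)\ge 1$, then $Z$ is not positive recurrent.
   Context: Vector inequalities are componentwise ($v>0$: all components positive; $v\ge 0$: all components nonnegative). A square matrix $R$ is completely-$\mathcal{S}$ if for each principal submatrix $M$ of $R$ (including $R$ itself) there is a vector $w\ge 0$ with $Mw>0$. SRBM. Put $S=\mathbb{R}^3_+$. A semimartingale reflecting Brownian motion (SRBM) with data $(\theta,\Gamma,R)$ is a continuous adapted process $Z$ with values in $S$, together with probability measures $\{\mathbb{P}_x, x\in S\}$, on a filtered space $(\Omega,\mathcal{F},\{\mathcal{F}_t\})$, such that for each $x\in S$, $\mathbb{P}_x$-a.s.: $Z(t)=X(t)+RY(t)$ for all $t\ge 0$, where $X(t)-\theta t$ is, under $\mathbb{P}_x$, a three-dimensional driftless Brownian motion with covariance matrix $\Gamma$ that starts at $x$ and is an $\{\mathcal{F}_t\}$-martingale; $Y$ is an adapted three-dimensional process, continuous and componentwise nondecreasing with $Y(0)=0$; and $\int_0^\infty 1_{\{Z_j(s)\ne 0\}}\,dY_j(s)=0$ for $j=1,2,3$. For completely-$\mathcal{S}$ $R$ such a $Z$ exists and is unique in law for each starting state. $Z$ is positive recurrent if $\mathbb{E}_x(\tau_A)<\infty$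 for every $x\in S$ and every open neighborhood $A$ of the origin (in $S$), where $\tau_A=\inf\{t\ge 0: Z(t)\in A\}$. The set $C$ and the gain $\beta$. $C_1$ is the set of pairs $(\theta,R)$ with $\theta<0$ and $$\theta_1>\theta_2R_{12},\ \theta_3<\theta_2R_{32},\quad \theta_2>\theta_3R_{23},\ \theta_1<\theta_3R_{13},\quad \theta_3>\theta_1R_{31},\ \theta_2<\theta_1R_{21}.$$ $C_2$ is the set of pairs $(\theta,R)$ with $\theta<0$ and all six of these displayed strict inequalities reversed. $C=C_1\cup C_2$. For $(\theta,R)\in C_1$, $$\beta(\theta,R)=\beta_1(\theta,R)=\Big(\frac{\theta_1-\theta_2R_{12}}{\theta_2R_{32}-\theta_3}\Big)\Big(\frac{\theta_2-\theta_3R_{23}}{\theta_3R_{13}-\theta_1}\Big)\Big(\frac{\theta_3-\theta_1R_{31}}{\theta_1R_{21}-\theta_2}\Big),$$ and for $(\theta,R)\in C_2$, $\beta(\theta,R)=\beta_2(\theta,R)$ is the reciprocal of the expression on the right-hand side of this display. *)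

theory Defs
  imports "HOL-Probability.Probability"
begin

section \<open>Matrices and vectors\<close>

definition sym_pos_def :: "real^'n^'n \<Rightarrow> bool" where
  "sym_pos_def A \<longleftrightarrow> transpose A = A \<and> (\<forall>v. v \<noteq> 0 \<longrightarrow> 0 < v \<bullet> (A *v v))"

text \<open>A principal submatrix is given by the set \<open>I\<close> of retained indices; only the entries of
  \<open>w\<close> with index in \<open>I\<close> are relevant.\<close>

definition completely_S :: "real^'n^'n \<Rightarrow> bool" where
  "completely_S R \<longleftrightarrow>
     (\<forall>I. I \<noteq> {} \<longrightarrow>
        (\<exists>w :: real^'n. (\<forall>i\<in>I. 0 \<le> w $ i) \<and> (\<forall>i\<in>I. 0 < (\<Sum>j\<in>I. R $ i $ j * w $ j))))"

definition nonneg_orthant :: "(real^'n) set" where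
  "nonneg_orthant = {x. \<forall>i. 0 \<le> x $ i}"


section \<open>Processes in continuous time\<close>

text \<open>Time is of type \<^typ>\<open>real\<close>, but only the values of a process at times \<open>t \<ge> 0\<close>
  are ever constrained.\<close>

definition adapted :: "(real \<Rightarrow> 'a measure) \<Rightarrow> (real \<Rightarrow> 'a \<Rightarrow> 'b::topological_space) \<Rightarrow> bool" where
  "adapted F X \<longleftrightarrow> (\<forall>t\<ge>0. X t \<in> borel_measurable (F t))"

definition vec_martingale ::
    "'a measure \<Rightarrow> (real \<Rightarrow> 'a measure) \<Rightarrow> (real \<Rightarrow> 'a \<Rightarrow> real^'n) \<Rightarrow> bool" where
  "vec_martingale M F W \<longleftrightarrow>
     adapted F W \<and>
     (\<forall>t\<ge>0. \<forall>i. integrable M (\<lambda>\<omega>. W t \<omega> $ i)) \<and>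
     (\<forall>s t. 0 \<le> s \<longrightarrow> s \<le> t \<longrightarrow>
        (\<forall>i. AE \<omega> in M. real_cond_exp M (F s) (\<lambda>\<omega>. W t \<omega> $ i) \<omega> = W s \<omega> $ i))"

text \<open>Density of the centred normal distribution with covariance matrix \<open>A\<close>, meaningful only
  for positive definite \<open>A\<close>.\<close>

definition normal_vec_density :: "real^'n^'n \<Rightarrow> real^'n \<Rightarrow> real" where
  "normal_vec_density A y =
     exp (- (y \<bullet> (matrix_inv A *v y)) / 2) / sqrt ((2 * pi) ^ CARD('n) * det A)"

text \<open>Driftless Brownian motion on the probability space \<open>M\<close>, started at \<open>x\<close>, with positive
  definite covariance matrix \<open>A\<close>. Every finite sequence of times extends to a monotone infinite
  one, and independence of an infinite family is that of its finite subfamilies.\<close>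

definition brownian_motion ::
    "'a measure \<Rightarrow> real^'n^'n \<Rightarrow> real^'n \<Rightarrow> (real \<Rightarrow> 'a \<Rightarrow> real^'n) \<Rightarrow> bool" where
  "brownian_motion M A x W \<longleftrightarrow>
     prob_space M \<and>
     (\<forall>t\<ge>0. W t \<in> borel_measurable M) \<and>
     (AE \<omega> in M. W 0 \<omega> = x) \<and>
     (AE \<omega> in M. continuous_on {0..} (\<lambda>t. W t \<omega>)) \<and>
     (\<forall>s t. 0 \<le> s \<longrightarrow> s < t \<longrightarrow>
        distributed M lborel (\<lambda>\<omega>. W t \<omega> - W s \<omega>) (normal_vec_density ((t - s) *\<^sub>R A))) \<and>
     (\<forall>\<tau> :: nat \<Rightarrow> real. 0 \<le> \<tau> 0 \<longrightarrow> mono \<tau> \<longrightarrow>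
        prob_space.indep_vars M (\<lambda>_. borel) (\<lambda>k \<omega>. W (\<tau> (Suc k)) \<omega> - W (\<tau> k) \<omega>) UNIV)"


section \<open>Semimartingale reflecting Brownian motion\<close>

text \<open>The conditions on the driving process \<open>X\<close> and the pushing process \<open>Y\<close> under one measure
  \<open>Q\<close> with starting state \<open>x\<close>. Paths of \<open>Y\<close> are extended constantly to negative times, so
  that \<open>interval_measure\<close> yields the Lebesgue--Stieltjes measure \<open>dY\<^sub>j\<close>.\<close>

definition srbm_decomposition ::
    "real^'n \<Rightarrow> real^'n^'n \<Rightarrow> real^'n^'n \<Rightarrow> (real \<Rightarrow> 'a measure) \<Rightarrow> 'a measure \<Rightarrow> real^'n \<Rightarrow>
     (real \<Rightarrow> 'a \<Rightarrow> real^'n) \<Rightarrow> (real \<Rightarrow> 'a \<Rightarrow> real^'n) \<Rightarrow> (real \<Rightarrow> 'a \<Rightarrow> real^'n) \<Rightarrow> bool" where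
  "srbm_decomposition \<theta> \<Gamma> R F Q x Z X Y \<longleftrightarrow>
     (AE \<omega> in Q. \<forall>t\<ge>0. Z t \<omega> = X t \<omega> + R *v Y t \<omega>) \<and>
     brownian_motion Q \<Gamma> x (\<lambda>t \<omega>. X t \<omega> - t *\<^sub>R \<theta>) \<and>
     vec_martingale Q F (\<lambda>t \<omega>. X t \<omega> - t *\<^sub>R \<theta>) \<and>
     adapted F Y \<and>
     (AE \<omega> in Q. continuous_on {0..} (\<lambda>t. Y t \<omega>)) \<and>
     (AE \<omega> in Q. \<forall>j. mono_on {0..} (\<lambda>t. Y t \<omega> $ j)) \<and>
     (AE \<omega> in Q. Y 0 \<omega> = 0) \<and>
     (AE \<omega> in Q. \<forall>j.
        (\<integral>\<^sup>+ s\<in>{0..}. indicator {s. Z s \<omega> $ j \<noteq> 0} s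
           \<partial>interval_measure (\<lambda>s. Y (max 0 s) \<omega> $ j)) = 0)"

text \<open>\<open>M\<close> only serves as the measurable space on which all the \<open>P x\<close> live; its own measure is
  irrelevant. Any filtration indexed by \<open>t \<ge> 0\<close> extends constantly to negative times.\<close>

definition srbm ::
    "real^'n \<Rightarrow> real^'n^'n \<Rightarrow> real^'n^'n \<Rightarrow> 'a measure \<Rightarrow> (real \<Rightarrow> 'a measure) \<Rightarrow>
     (real^'n \<Rightarrow> 'a measure) \<Rightarrow> (real \<Rightarrow> 'a \<Rightarrow> real^'n) \<Rightarrow> bool" where
  "srbm \<theta> \<Gamma> R M F P Z \<longleftrightarrow>
     filtration (space M) F \<and> (\<forall>t. subalgebra M (F t)) \<and>
     adapted F Z \<and>
     (\<forall>\<omega>\<in>space M. continuous_on {0..} (\<lambda>t. Z t \<omega>) \<and> (\<forall>t\<ge>0. Z t \<omega> \<in> nonneg_orthant)) \<and>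
     (\<forall>x\<in>nonneg_orthant.
        prob_space (P x) \<and> sets (P x) = sets M \<and>
        (\<exists>X Y. srbm_decomposition \<theta> \<Gamma> R F (P x) x Z X Y))"

definition hitting_time :: "(real \<Rightarrow> 'a \<Rightarrow> 'b) \<Rightarrow> 'b set \<Rightarrow> 'a \<Rightarrow> ennreal" where
  "hitting_time Z A \<omega> = Inf {ennreal t | t. 0 \<le> t \<and> Z t \<omega> \<in> A}"

definition positive_recurrent ::
    "(real^'n \<Rightarrow> 'a measure) \<Rightarrow> (real \<Rightarrow> 'a \<Rightarrow> real^'n) \<Rightarrow> bool" where
  "positive_recurrent P Z \<longleftrightarrow>
     (\<forall>x\<in>nonneg_orthant. \<forall>A. openin (top_of_set nonneg_orthant) A \<longrightarrow> 0 \<in> A \<longrightarrow>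
        (\<integral>\<^sup>+ \<omega>. hitting_time Z A \<omega> \<partial>P x) < \<infinity>)"


section \<open>The set \<open>C\<close> and the gain\<close>

definition C1 :: "((real^3) \<times> (real^3^3)) set" where
  "C1 = {(\<theta>, R). (\<forall>i. \<theta> $ i < 0) \<and>
     \<theta> $ 1 > \<theta> $ 2 * R $ 1 $ 2 \<and> \<theta> $ 3 < \<theta> $ 2 * R $ 3 $ 2 \<and>
     \<theta> $ 2 > \<theta> $ 3 * R $ 2 $ 3 \<and> \<theta> $ 1 < \<theta> $ 3 * R $ 1 $ 3 \<and>
     \<theta> $ 3 > \<theta> $ 1 * R $ 3 $ 1 \<and> \<theta> $ 2 < \<theta> $ 1 * R $ 2 $ 1}"

definition C2 :: "((real^3) \<times> (real^3^3)) set" where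
  "C2 = {(\<theta>, R). (\<forall>i. \<theta> $ i < 0) \<and>
     \<theta> $ 1 < \<theta> $ 2 * R $ 1 $ 2 \<and> \<theta> $ 3 > \<theta> $ 2 * R $ 3 $ 2 \<and>
     \<theta> $ 2 < \<theta> $ 3 * R $ 2 $ 3 \<and> \<theta> $ 1 > \<theta> $ 3 * R $ 1 $ 3 \<and>
     \<theta> $ 3 < \<theta> $ 1 * R $ 3 $ 1 \<and> \<theta> $ 2 > \<theta> $ 1 * R $ 2 $ 1}"

definition beta1 :: "real^3 \<Rightarrow> real^3^3 \<Rightarrow> real" where
  "beta1 \<theta> R =
     ((\<theta> $ 1 - \<theta> $ 2 * R $ 1 $ 2) / (\<theta> $ 2 * R $ 3 $ 2 - \<theta> $ 3)) *
     ((\<theta> $ 2 - \<theta> $ 3 * R $ 2 $ 3) / (\<theta> $ 3 * R $ 1 $ 3 - \<theta> $ 1)) *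
     ((\<theta> $ 3 - \<theta> $ 1 * R $ 3 $ 1) / (\<theta> $ 1 * R $ 2 $ 1 - \<theta> $ 2))"

definition beta2 :: "real^3 \<Rightarrow> real^3^3 \<Rightarrow> real" where
  "beta2 \<theta> R = 1 / beta1 \<theta> R"

text \<open>\<open>C1\<close> and \<open>C2\<close> are disjoint; outside \<open>C1 \<union> C2\<close> the value carries no meaning.\<close>

definition beta :: "real^3 \<Rightarrow> real^3^3 \<Rightarrow> real" where
  "beta \<theta> R = (if (\<theta>, R) \<in> C1 then beta1 \<theta> R else beta2 \<theta> R)"

end

theory Submission
  imports Defs
begin

text \<open>
  The fluid paths of the process spiral along the boundary: from a coordinate axis the path crosses
  a face to the next axis, and \<open>\<beta>\<close> is the factor by which the distance to the origin changes in one
  turn. That \<open>\<beta> \<ge> 1\<close> turns into a positive weight vector \<open>u\<close> for which each single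
  pushing direction compensates the drift: \<open>\<theta>\<^sub>j (u \<bullet> R\<^sup>j) \<le> u \<bullet> \<theta>\<close> for each column \<open>R\<^sup>j\<close>
  (lemma \<open>gain_weights\<close>). Put \<open>g\<^sub>J = u - (u \<bullet> \<theta> / \<theta>\<^sub>J) e\<^sub>J\<close>. Each \<open>g\<^sub>J\<close> annihilates the drift, so
  \<open>g\<^sub>J \<bullet> Z\<close> is a martingale plus a contribution of the pushing process \<open>Y\<close>, and pushing in
  direction \<open>R\<^sup>j\<close> increases \<open>g\<^sub>J \<bullet> Z\<close> unless \<open>j\<close> is the coordinate that follows \<open>J\<close> in the cyclic order
  of the spiral (lemma \<open>weights_give_switching_functionals\<close>). When that coordinate \<open>j\<close> reaches zero,
  replacing \<open>g\<^sub>J\<close> by \<open>g\<^sub>j\<close> does not lower the value, since \<open>Z\<^sub>j = 0\<close> and \<open>Z\<^sub>J \<ge> 0\<close>. So the value of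
  the currently active functional dominates a martingale that starts at \<open>g \<bullet> x\<close>. Switches
  accumulate only where all coordinates vanish together, that is, at the origin.

  If the unit ball were hit after a finite mean time, the martingale stopped at the hitting time
  would have mean zero and bounded second moment. Yet at that time the functional is bounded by a
  constant, so that for a starting point far enough away the martingale would be at most \<open>-1\<close> almost
  surely. This is impossible.

  The argument is carried out on the time grid of mesh \<open>1/m\<close>, where the martingale
  becomes a finite sum of weighted increments. On the grid the active functional is switched as
  soon as the pushing component of the next coordinate has grown during the last step, which is
  decided by \<open>Y\<close> at grid times and hence adapted. Each such delayed switch costs an error that is
  bounded by the modulus of continuity of the path; as the number of switches before the hitting time
  is bounded independently of \<open>m\<close> (lemma \<open>few_switches\<close>), the total error vanishes as
  \<open>m \<rightarrow> \<infinity>\<close> (lemma \<open>transform_eventually_negative\<close>). On the probabilistic side, lemma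
  \<open>conditional_second_moment\<close> yields the bound on the second moment (lemma \<open>transform_bounds\<close>), and
  lemma \<open>mean_zero_not_eventually_negative\<close> yields the contradiction.
\<close>

section \<open>Moments of Brownian increments\<close>

lemma lborel_scaleR_integral:
  fixes f :: "'a::euclidean_space \<Rightarrow> real"
  assumes c: "0 < c" and [measurable]: "f \<in> borel_measurable borel"
  shows "integrable lborel f \<longleftrightarrow> integrable lborel (\<lambda>x. f (c *\<^sub>R x))"
    and "(\<integral>x. f x \<partial>lborel) = c ^ DIM('a) * (\<integral>x. f (c *\<^sub>R x) \<partial>lborel)"
proof -
  have eq: "lborel = density (distr lborel borel (\<lambda>x::'a. c *\<^sub>R x)) (\<lambda>_. ennreal (c ^ DIM('a)))"
    using lborel_affine[of c "0::'a"] c by simp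
  have "integrable lborel f \<longleftrightarrow>
      integrable (density (distr lborel borel (\<lambda>x::'a. c *\<^sub>R x)) (\<lambda>_. ennreal (c ^ DIM('a)))) f"
    using eq by simp
  also have "\<dots> \<longleftrightarrow> integrable lborel (\<lambda>x. c ^ DIM('a) *\<^sub>R f (c *\<^sub>R x))"
    using c by (subst integrable_density) (auto simp: integrable_distr_eq)
  also have "\<dots> \<longleftrightarrow> integrable lborel (\<lambda>x. f (c *\<^sub>R x))"
    using c by simp
  finally show "integrable lborel f \<longleftrightarrow> integrable lborel (\<lambda>x. f (c *\<^sub>R x))" .
  have "(\<integral>x. f x \<partial>lborel) =
      (\<integral>x. f x \<partial>density (distr lborel borel (\<lambda>x::'a. c *\<^sub>R x)) (\<lambda>_. ennreal (c ^ DIM('a))))"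
    using eq by simp
  also have "\<dots> = (\<integral>x. c ^ DIM('a) *\<^sub>R f (c *\<^sub>R x) \<partial>lborel)"
    using c by (subst integral_density) (auto simp: integral_distr)
  finally show "(\<integral>x. f x \<partial>lborel) = c ^ DIM('a) * (\<integral>x. f (c *\<^sub>R x) \<partial>lborel)"
    by simp
qed

lemma sym_pos_def_invertible:
  fixes A :: "real^'n^'n"
  assumes "sym_pos_def A"
  shows "invertible A"
proof -
  have "\<And>x. A *v x = 0 \<Longrightarrow> x = 0"
    using assms by (metis inner_zero_right less_irrefl sym_pos_def_def)
  then show ?thesis
    by (metis invertible_left_inverse matrix_left_invertible_ker)
qed

lemma matrix_inv_inverse:
  fixes A :: "real^'n^'n"
  assumes "invertible A"
  shows "A ** matrix_inv A = mat 1" "matrix_inv A ** A = mat 1"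
  using someI_ex[OF assms[unfolded invertible_def]] by (auto simp: matrix_inv_def)

lemma matrix_inv_scaleR:
  fixes A :: "real^'n^'n"
  assumes A: "invertible A" and h: "h \<noteq> 0"
  shows "matrix_inv (h *\<^sub>R A) = (1 / h) *\<^sub>R matrix_inv A"
proof -
  let ?B = "(1 / h) *\<^sub>R matrix_inv A"
  have r: "(h *\<^sub>R A) ** ?B = mat 1"
    using h matrix_inv_inverse[OF A] by (simp add: matrix_scalar_ac scalar_matrix_assoc[symmetric])
  then have "invertible (h *\<^sub>R A)" by (auto simp: invertible_right_inverse)
  from matrix_inv_inverse[OF this] r show ?thesis
    by (metis matrix_mul_assoc matrix_mul_lid matrix_mul_rid)
qed

lemma sym_pos_def_inv_coercive:
  fixes A :: "real^'n^'n"
  assumes "sym_pos_def A"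
  obtains l where "l > 0" "\<And>y. l * (norm y)\<^sup>2 \<le> y \<bullet> (matrix_inv A *v y)"
proof -
  let ?q = "\<lambda>y. y \<bullet> (matrix_inv A *v y)"
  have pos: "?q y > 0" if "y \<noteq> 0" for y
  proof -
    define w where "w = matrix_inv A *v y"
    have y: "y = A *v w"
      using sym_pos_def_invertible[OF assms]
      by (simp add: w_def matrix_vector_mul_assoc matrix_inv_inverse)
    then have "w \<noteq> 0" using that by auto
    then have "w \<bullet> (A *v w) > 0" using assms by (auto simp: sym_pos_def_def)
    then show ?thesis using y w_def by (metis inner_commute)
  qed
  have cont: "continuous_on (sphere 0 1) ?q"
    by (rule continuous_on_inner[OF continuous_on_id matrix_vector_mult_linear_continuous_on])
  have "axis undefined 1 \<in> sphere (0::real^'n) 1" by (simp add: norm_axis_1)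
  then have "sphere (0::real^'n) 1 \<noteq> {}" by blast
  from continuous_attains_inf[OF compact_sphere this cont]
  obtain y0 where y0: "y0 \<in> sphere 0 1" "\<And>y. y \<in> sphere 0 1 \<Longrightarrow> ?q y0 \<le> ?q y"
    by blast
  show ?thesis
  proof
    show "?q y0 > 0" using y0 by (intro pos) auto
    fix y :: "real^'n"
    show "?q y0 * (norm y)\<^sup>2 \<le> ?q y"
    proof (cases "y = 0")
      case False
      then have "?q y0 \<le> ?q ((1 / norm y) *\<^sub>R y)" by (intro y0) auto
      also have "\<dots> = ?q y / (norm y)\<^sup>2"
        by (simp add: matrix_vector_mult_scaleR power2_eq_square)
      finally show ?thesis using False by (simp add: field_simps)
    qed auto
  qed
qed

lemma normal_vec_density_scaleR:
  fixes A :: "real^'n^'n"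
  assumes "invertible A" "0 < h"
  shows "normal_vec_density (h *\<^sub>R A) (sqrt h *\<^sub>R z) = normal_vec_density A z / sqrt h ^ CARD('n)"
proof -
  have "det (h *\<^sub>R A) = h ^ CARD('n) * det A"
    by (simp add: det_def prod.distrib sum_distrib_left mult_ac)
  then show ?thesis
    using assms by (simp add: normal_vec_density_def matrix_inv_scaleR real_sqrt_mult real_sqrt_power
        matrix_vector_mult_scaleR scaleR_matrix_vector_assoc[symmetric] power_mult_distrib field_simps)
qed

text \<open>Half of the exponent dominates the fourth power by coercivity. What remains is the unnormalised
  density for the covariance matrix \<open>2 A\<close>; as a probability density, that one is integrable.\<close>
lemma gaussian_fourth_moment_integrable:
  fixes A :: "real^'n^'n"
  assumes A: "sym_pos_def A" and int2: "integrable lborel (normal_vec_density (2 *\<^sub>R A))"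
  shows "integrable lborel (\<lambda>y. normal_vec_density A y * (y $ i) ^ 4)"
proof -
  define q where "q = (\<lambda>y. y \<bullet> (matrix_inv A *v y))"
  obtain l where l: "l > 0" "\<And>y. l * (norm y)\<^sup>2 \<le> q y"
    using sym_pos_def_inv_coercive[OF A] unfolding q_def by blast
  define K where "K = sqrt ((2 * pi) ^ CARD('n) * det A)"
  define K2 where "K2 = sqrt ((2 * pi) ^ CARD('n) * det (2 *\<^sub>R A))"
  have inv: "invertible A" by (rule sym_pos_def_invertible[OF A])
  have det2: "det (2 *\<^sub>R A) = 2 ^ CARD('n) * det A"
    by (simp add: det_def prod.distrib sum_distrib_left mult_ac)
  have "K2 \<noteq> 0" using inv by (simp add: K2_def det2 invertible_det_nz)
  have d2: "normal_vec_density (2 *\<^sub>R A) y = exp (- q y / 4) / K2" for y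
    using inv by (simp add: normal_vec_density_def q_def K2_def matrix_inv_scaleR scaleR_matrix_vector_assoc[symmetric])
  have "integrable lborel (\<lambda>y. K2 * normal_vec_density (2 *\<^sub>R A) y)"
    using int2 by simp
  then have int: "integrable lborel (\<lambda>y. exp (- q y / 4))"
    using \<open>K2 \<noteq> 0\<close> by (simp add: d2)
  have [measurable]: "q \<in> borel_measurable borel"
    unfolding q_def
    by (rule borel_measurable_continuous_onI)
       (rule continuous_on_inner[OF continuous_on_id matrix_vector_mult_linear_continuous_on])
  have bound: "(y $ i) ^ 4 * exp (- q y / 2) \<le> 32 / l\<^sup>2 * exp (- q y / 4)" for y
  proof -
    define r where "r = l * (norm y)\<^sup>2 / 4"
    have "r \<ge> 0" using l by (simp add: r_def)
    have "(y $ i) ^ 4 \<le> norm y ^ 4"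
      using power_mono[OF component_le_norm_cart, of y i 4] by simp
    also have "\<dots> = 16 / l\<^sup>2 * r\<^sup>2"
      using l by (simp add: r_def power2_eq_square power4_eq_xxxx)
    also have "\<dots> \<le> 16 / l\<^sup>2 * (2 * exp r)"
      using exp_lower_Taylor_quadratic[OF \<open>r \<ge> 0\<close>] \<open>r \<ge> 0\<close> by (intro mult_left_mono) auto
    also have "\<dots> \<le> 32 / l\<^sup>2 * exp (q y / 4)"
      using l(2)[of y] by (simp add: r_def divide_right_mono)
    finally have "(y $ i) ^ 4 * exp (- q y / 2) \<le> 32 / l\<^sup>2 * exp (q y / 4) * exp (- q y / 2)"
      by (intro mult_right_mono) auto
    also have "\<dots> = 32 / l\<^sup>2 * exp (- q y / 4)"
      by (simp add: exp_add[symmetric])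
    finally show ?thesis .
  qed
  have "integrable lborel (\<lambda>y. (y $ i) ^ 4 * exp (- q y / 2))"
  proof (rule Bochner_Integration.integrable_bound)
    show "integrable lborel (\<lambda>y. 32 / l\<^sup>2 * exp (- q y / 4))" using int by simp
  qed (use bound in \<open>auto simp: abs_mult\<close>)
  then have "integrable lborel (\<lambda>y. (1 / K) * ((y $ i) ^ 4 * exp (- q y / 2)))"
    by simp
  then show ?thesis by (simp add: normal_vec_density_def q_def K_def mult_ac)
qed

text \<open>The increment over \<open>[s, t]\<close> has the law of \<open>sqrt (t - s)\<close> times the increment over unit time, so
  the second and fourth moments are proportional to \<open>t - s\<close> and \<open>(t - s)\<^sup>2\<close>. What counts is
  that the fourth moment is of smaller order than the second as the interval shrinks.\<close>
lemma brownian_increment_moments: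
  fixes A :: "real^'n^'n"
  assumes bm: "brownian_motion M A x W" and A: "sym_pos_def A"
  obtains c v where "0 \<le> c"
    and "\<And>s t. 0 \<le> s \<Longrightarrow> s < t \<Longrightarrow> integrable M (\<lambda>\<omega>. ((W t \<omega> - W s \<omega>) $ i) ^ 4)"
    and "\<And>s t. 0 \<le> s \<Longrightarrow> s < t \<Longrightarrow> (\<integral>\<omega>. ((W t \<omega> - W s \<omega>) $ i) ^ 2 \<partial>M) = c * (t - s)"
    and "\<And>s t. 0 \<le> s \<Longrightarrow> s < t \<Longrightarrow> (\<integral>\<omega>. ((W t \<omega> - W s \<omega>) $ i) ^ 4 \<partial>M) = v * (t - s)\<^sup>2"
proof -
  interpret prob_space M using bm by (simp add: brownian_motion_def)
  let ?f = "\<lambda>h. normal_vec_density (h *\<^sub>R A)"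
  have inv: "invertible A" by (rule sym_pos_def_invertible[OF A])
  have dist: "distributed M lborel (\<lambda>\<omega>. W t \<omega> - W s \<omega>) (?f (t - s))" if "0 \<le> s" "s < t" for s t
    using bm that by (simp add: brownian_motion_def)
  \<comment> \<open>A negative determinant would make the square root, hence the density, negative everywhere,
    and a negative density is read as \<open>0\<close>, which has no mass.\<close>
  have nonneg: "0 \<le> ?f h y" if "0 < h" for h y
  proof (rule ccontr)
    assume neg: "\<not> 0 \<le> ?f h y"
    let ?K = "sqrt ((2 * pi) ^ CARD('n) * det (h *\<^sub>R A))"
    have "?K < 0"
      using neg unfolding normal_vec_density_def not_le divide_less_0_iff by (auto simp: not_less_iff_gr_or_eq)
    then have "?f h z \<le> 0" for z
      by (auto simp: normal_vec_density_def divide_nonneg_neg divide_le_0_iff)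
    then have "(\<lambda>z. ennreal (?f h z)) = (\<lambda>z. 0)" by (simp add: ennreal_neg fun_eq_iff)
    moreover have "distr M lborel (\<lambda>\<omega>. W h \<omega> - W 0 \<omega>) = density lborel (?f h)"
      using dist[of 0 h] that by (simp add: distributed_def)
    ultimately have "emeasure (distr M lborel (\<lambda>\<omega>. W h \<omega> - W 0 \<omega>)) UNIV = 0"
      by (simp add: emeasure_density)
    moreover have "emeasure (distr M lborel (\<lambda>\<omega>. W h \<omega> - W 0 \<omega>)) UNIV = 1"
      using dist[of 0 h] that
      by (subst emeasure_distr) (auto simp: distributed_def emeasure_space_1)
    ultimately show False by simp
  qed
  have meas: "?f h \<in> borel_measurable borel" if "0 < h" for h
  proof -
    have "?f h \<in> borel_measurable lborel"
      by (rule distributed_real_measurable[where M = M and X = "\<lambda>\<omega>. W h \<omega> - W 0 \<omega>"])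
        (use dist[of 0 h] that nonneg[OF that] in simp_all)
    then show ?thesis by simp
  qed
  have "integrable lborel (?f 2)"
    using distributed_integrable[OF dist[of 0 2], of "\<lambda>_. 1"] nonneg by simp
  note int4 = gaussian_fourth_moment_integrable[OF A this, of i]
  \<comment> \<open>Substitution of \<open>sqrt (t - s) y\<close> for the variable turns a moment into the moment of the increment over unit time.\<close>
  have scale: "(\<integral>\<omega>. g (W t \<omega> - W s \<omega>) \<partial>M) = (t - s) ^ p * (\<integral>y. ?f 1 y * g y \<partial>lborel)"
    and scale_int: "integrable lborel (\<lambda>y. ?f 1 y * g y) \<Longrightarrow> integrable M (\<lambda>\<omega>. g (W t \<omega> - W s \<omega>))"
    if st: "0 \<le> s" "s < t" and g[measurable]: "g \<in> borel_measurable borel"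
      and hom: "\<And>h y. h > 0 \<Longrightarrow> g (sqrt h *\<^sub>R y) = h ^ p * g y" for s t p and g :: "real^'n \<Rightarrow> real"
  proof -
    define h where "h = t - s"
    have "h > 0" using st by (simp add: h_def)
    note [measurable] = meas[OF this]
    have sub: "?f h (sqrt h *\<^sub>R y) * g (sqrt h *\<^sub>R y) = h ^ p / sqrt h ^ CARD('n) * (?f 1 y * g y)" for y
      using \<open>h > 0\<close> by (simp add: hom normal_vec_density_scaleR[OF inv])
    have "(\<integral>\<omega>. g (W t \<omega> - W s \<omega>) \<partial>M) = (\<integral>y. ?f h y * g y \<partial>lborel)"
      using dist[OF st] nonneg[OF \<open>h > 0\<close>] by (subst distributed_integral) (auto simp: h_def)
    also have "\<dots> = h ^ p * (\<integral>y. ?f 1 y * g y \<partial>lborel)"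
      using \<open>h > 0\<close> by (subst lborel_scaleR_integral(2)[where c = "sqrt h"]) (auto simp: sub)
    finally show "(\<integral>\<omega>. g (W t \<omega> - W s \<omega>) \<partial>M) = (t - s) ^ p * (\<integral>y. ?f 1 y * g y \<partial>lborel)"
      by (simp add: h_def)
    assume "integrable lborel (\<lambda>y. ?f 1 y * g y)"
    then have "integrable lborel (\<lambda>y. ?f h y * g y)"
      using \<open>h > 0\<close> by (subst lborel_scaleR_integral(1)[where c = "sqrt h"]) (auto simp: sub)
    then show "integrable M (\<lambda>\<omega>. g (W t \<omega> - W s \<omega>))"
      using distributed_integrable[OF dist[OF st], of g] nonneg[OF \<open>h > 0\<close>] by (simp add: h_def)
  qed
  show ?thesis
  proof
    show "0 \<le> (\<integral>y. ?f 1 y * (y $ i)\<^sup>2 \<partial>lborel)"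
      using nonneg[of 1] by (intro integral_nonneg_AE) auto
    fix s t :: real assume st: "0 \<le> s" "s < t"
    show "integrable M (\<lambda>\<omega>. ((W t \<omega> - W s \<omega>) $ i) ^ 4)"
      by (rule scale_int[OF st, of "\<lambda>y. (y $ i) ^ 4" 2])
         (use int4 in \<open>auto simp: power_mult_distrib power4_eq_xxxx power2_eq_square\<close>)
    show "(\<integral>\<omega>. ((W t \<omega> - W s \<omega>) $ i) ^ 2 \<partial>M) = (\<integral>y. ?f 1 y * (y $ i)\<^sup>2 \<partial>lborel) * (t - s)"
      by (subst scale[OF st, of "\<lambda>y. (y $ i) ^ 2" 1])
         (auto simp: power_mult_distrib)
    show "(\<integral>\<omega>. ((W t \<omega> - W s \<omega>) $ i) ^ 4 \<partial>M) = (\<integral>y. ?f 1 y * (y $ i) ^ 4 \<partial>lborel) * (t - s)\<^sup>2"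
      by (subst scale[OF st, of "\<lambda>y. (y $ i) ^ 4" 2])
         (auto simp: power_mult_distrib power4_eq_xxxx power2_eq_square)
  qed
qed

lemma sq_integrable_mult:
  fixes f g :: "'a \<Rightarrow> real" and M :: "'a measure"
  assumes "f \<in> borel_measurable M" "g \<in> borel_measurable M"
    and "integrable M (\<lambda>\<omega>. (f \<omega>)\<^sup>2)" "integrable M (\<lambda>\<omega>. (g \<omega>)\<^sup>2)"
  shows "integrable M (\<lambda>\<omega>. f \<omega> * g \<omega>)"
proof (rule Bochner_Integration.integrable_bound)
  show "integrable M (\<lambda>\<omega>. (f \<omega>)\<^sup>2 + (g \<omega>)\<^sup>2)" using assms by simp
  have "\<bar>a * b\<bar> \<le> a\<^sup>2 + b\<^sup>2" for a b :: real
  proof -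
    have "0 \<le> \<bar>a\<bar> * \<bar>b\<bar>" by simp
    then show ?thesis
      using sum_squares_bound[of "\<bar>a\<bar>" "\<bar>b\<bar>"] by (simp only: abs_mult power2_abs mult.assoc)
  qed
  then show "AE \<omega> in M. norm (f \<omega> * g \<omega>) \<le> norm ((f \<omega>)\<^sup>2 + (g \<omega>)\<^sup>2)"
    by simp
qed (use assms in simp)

section \<open>Brownian motion as a martingale of a larger filtration\<close>

text \<open>A Brownian motion that is a martingale for a filtration which may be larger than its own.
  As \<open>F\<close> may
  contain more than the past of \<open>W\<close>, the increments are only orthogonal to it; conditional second
  moments take over the role that independence has for the natural filtration.\<close>
locale brownian_martingale = prob_space M for M :: "'a measure" +
  fixes F :: "real \<Rightarrow> 'a measure" and W :: "real \<Rightarrow> 'a \<Rightarrow> real^'n"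
    and A :: "real^'n^'n" and x :: "real^'n"
  assumes pos_def: "sym_pos_def A"
    and brownian: "brownian_motion M A x W"
    and martingale: "vec_martingale M F W"
    and subalg: "\<And>t. subalgebra M (F t)"
    and sets_mono: "\<And>s t. s \<le> t \<Longrightarrow> sets (F s) \<subseteq> sets (F t)"
begin

abbreviation incr :: "'n \<Rightarrow> real \<Rightarrow> real \<Rightarrow> 'a \<Rightarrow> real" where
  "incr i s t \<omega> \<equiv> W t \<omega> $ i - W s \<omega> $ i"

lemma measurable_from_F: "f \<in> borel_measurable (F t) \<Longrightarrow> f \<in> borel_measurable M"
  by (rule measurable_from_subalg[OF subalg])

lemma measurable_F_mono:
  assumes "s \<le> t" "f \<in> measurable (F s) N"
  shows "f \<in> measurable (F t) N"
proof -
  have "space (F s) = space (F t)" using subalg unfolding subalgebra_def by metis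
  then have "subalgebra (F t) (F s)" using sets_mono[OF assms(1)] by (auto simp: subalgebra_def)
  then show ?thesis by (rule measurable_from_subalg) (fact assms(2))
qed

lemma W_adapted: "0 \<le> t \<Longrightarrow> W t \<in> borel_measurable (F t)"
  using martingale by (simp add: vec_martingale_def adapted_def)

lemma component_F: "0 \<le> s \<Longrightarrow> s \<le> t \<Longrightarrow> (\<lambda>\<omega>. W s \<omega> $ i) \<in> borel_measurable (F t)"
  by (rule measurable_compose[OF measurable_F_mono[OF _ W_adapted]])
     (auto intro!: borel_measurable_continuous_onI continuous_intros)

lemma component_M[measurable]: "0 \<le> t \<Longrightarrow> (\<lambda>\<omega>. W t \<omega> $ i) \<in> borel_measurable M"
  using measurable_from_F[OF component_F] by auto

lemma incr_M: "0 \<le> s \<Longrightarrow> s \<le> t \<Longrightarrow> incr i s t \<in> borel_measurable M"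
  by (intro borel_measurable_diff component_M) auto

lemma incr_sq_integrable:
  assumes "0 \<le> s" "s \<le> t"
  shows "integrable M (\<lambda>\<omega>. (incr i s t \<omega>)\<^sup>2)"
proof (cases "s = t")
  case False
  obtain c v where "integrable M (\<lambda>\<omega>. ((W t \<omega> - W s \<omega>) $ i) ^ 4)"
    using brownian_increment_moments[OF brownian pos_def, of i] assms False by (metis less_eq_real_def)
  then have int4: "integrable M (\<lambda>\<omega>. (incr i s t \<omega>) ^ 4)" by simp
  show ?thesis
  proof (rule Bochner_Integration.integrable_bound)
    show "integrable M (\<lambda>\<omega>. 1 + (incr i s t \<omega>) ^ 4)" using int4 by simp
    have "y\<^sup>2 \<le> 1 + y ^ 4" for y :: real
      using sum_squares_ge_zero[of "y\<^sup>2 - 1" y]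
      by (simp add: power2_eq_square power4_eq_xxxx algebra_simps)
    then show "AE \<omega> in M. norm ((incr i s t \<omega>)\<^sup>2) \<le> norm (1 + (incr i s t \<omega>) ^ 4)"
      by simp
  qed (use incr_M[OF assms] in simp)
qed simp

lemma incr_orthogonal:
  assumes st: "0 \<le> s" "s \<le> t" and H: "H \<in> borel_measurable (F s)"
    and int: "integrable M (\<lambda>\<omega>. H \<omega> * incr i s t \<omega>)"
  shows "(\<integral>\<omega>. H \<omega> * incr i s t \<omega> \<partial>M) = 0"
proof -
  interpret finite_measure_subalgebra M "F s"
    using subalg by unfold_locales
  have intW: "integrable M (\<lambda>\<omega>. W t \<omega> $ i)" "integrable M (\<lambda>\<omega>. W s \<omega> $ i)"
    using martingale st by (auto simp: vec_martingale_def)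
  have "AE \<omega> in M. real_cond_exp M (F s) (incr i s t) \<omega>
      = real_cond_exp M (F s) (\<lambda>\<omega>. W t \<omega> $ i) \<omega> - real_cond_exp M (F s) (\<lambda>\<omega>. W s \<omega> $ i) \<omega>"
    by (rule real_cond_exp_diff[OF intW])
  moreover have "AE \<omega> in M. real_cond_exp M (F s) (\<lambda>\<omega>. W t \<omega> $ i) \<omega> = W s \<omega> $ i"
    using martingale st by (auto simp: vec_martingale_def)
  moreover have "AE \<omega> in M. real_cond_exp M (F s) (\<lambda>\<omega>. W s \<omega> $ i) \<omega> = W s \<omega> $ i"
    using intW(2) component_F[of s s i] st by (intro real_cond_exp_F_meas) auto
  ultimately have zero: "AE \<omega> in M. H \<omega> * real_cond_exp M (F s) (incr i s t) \<omega> = 0"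
    by eventually_elim simp
  have "(\<integral>\<omega>. H \<omega> * incr i s t \<omega> \<partial>M) = (\<integral>\<omega>. H \<omega> * real_cond_exp M (F s) (incr i s t) \<omega> \<partial>M)"
    by (intro real_cond_exp_intg(2)[symmetric] int H incr_M[OF st])
  also have "\<dots> = 0" using zero by (rule integral_eq_zero_AE)
  finally show ?thesis .
qed

text \<open>Quadratic variation along a uniform partition: the centred squares of the increments are
  independent, so their variances of order \<open>h\<^sup>2\<close> add up. With \<open>N = T / h\<close> terms the total is of
  order \<open>h\<close>.\<close>
lemma sum_of_centred_squares:
  assumes c: "\<And>s t. 0 \<le> s \<Longrightarrow> s < t \<Longrightarrow> (\<integral>\<omega>. (incr i s t \<omega>)\<^sup>2 \<partial>M) = c * (t - s)"
    and int4: "\<And>s t. 0 \<le> s \<Longrightarrow> s < t \<Longrightarrow> integrable M (\<lambda>\<omega>. (incr i s t \<omega>) ^ 4)"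
    and v: "\<And>s t. 0 \<le> s \<Longrightarrow> s < t \<Longrightarrow> (\<integral>\<omega>. (incr i s t \<omega>) ^ 4 \<partial>M) = v * (t - s)\<^sup>2"
    and s: "0 \<le> s" and h: "0 < h"
  defines "\<xi> \<equiv> \<lambda>k \<omega>. (incr i (s + real k * h) (s + real (Suc k) * h) \<omega>)\<^sup>2 - c * h"
  shows "integrable M (\<lambda>\<omega>. (\<Sum>k<N. \<xi> k \<omega>)\<^sup>2)"
    and "(\<integral>\<omega>. (\<Sum>k<N. \<xi> k \<omega>)\<^sup>2 \<partial>M) \<le> real N * v * h\<^sup>2"
proof -
  let ?\<tau> = "\<lambda>k. s + real k * h"
  have \<tau>: "0 \<le> ?\<tau> k" "?\<tau> k < ?\<tau> (Suc k)" "?\<tau> (Suc k) - ?\<tau> k = h" for k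
    using s h by (auto simp: algebra_simps)
  have "mono ?\<tau>" using h by (intro monoI) (auto simp: mult_right_mono)
  then have "indep_vars (\<lambda>_. borel) (\<lambda>k \<omega>. W (?\<tau> (Suc k)) \<omega> - W (?\<tau> k) \<omega>) UNIV"
    using brownian[unfolded brownian_motion_def, THEN conjunct2, THEN conjunct2, THEN conjunct2,
        THEN conjunct2, THEN conjunct2, rule_format, of ?\<tau>] s by simp
  then have indep: "indep_vars (\<lambda>_. borel) \<xi> UNIV"
    using indep_vars_compose2[where Y = "\<lambda>_ y. (y $ i)\<^sup>2 - c * h" and N = "\<lambda>_. borel"]
    unfolding \<xi>_def by fastforce
  define I where "I = (\<lambda>k. incr i (?\<tau> k) (?\<tau> (Suc k)))"
  have \<xi>_I: "\<xi> k \<omega> = (I k \<omega>)\<^sup>2 - c * h" for k \<omega> by (simp add: \<xi>_def I_def)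
  have int_sq: "integrable M (\<lambda>\<omega>. (I k \<omega>)\<^sup>2)" for k
    unfolding I_def using \<tau>[of k] by (intro incr_sq_integrable) auto
  have int_4: "integrable M (\<lambda>\<omega>. (I k \<omega>) ^ 4)" for k
    unfolding I_def by (rule int4[OF \<tau>(1,2)])
  have exp2: "(\<integral>\<omega>. (I k \<omega>)\<^sup>2 \<partial>M) = c * h" and exp4: "(\<integral>\<omega>. (I k \<omega>) ^ 4 \<partial>M) = v * h\<^sup>2" for k
    using c[OF \<tau>(1,2), of k] v[OF \<tau>(1,2), of k] unfolding \<tau>(3) I_def by auto
  have int_\<xi>: "integrable M (\<xi> k)" for k
    using int_sq[of k] by (simp add: \<xi>_I[abs_def])
  have mean: "(\<integral>\<omega>. \<xi> k \<omega> \<partial>M) = 0" for k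
    using int_sq[of k] by (simp add: \<xi>_I exp2 prob_space)
  have sq: "(\<xi> k \<omega>)\<^sup>2 = (I k \<omega>) ^ 4 - 2 * c * h * (I k \<omega>)\<^sup>2 + (c * h)\<^sup>2" for k \<omega>
    by (simp add: \<xi>_I power2_eq_square power4_eq_xxxx algebra_simps)
  have int_\<xi>2: "integrable M (\<lambda>\<omega>. (\<xi> k \<omega>)\<^sup>2)" for k
    unfolding sq using int_sq[of k] int_4[of k] by simp
  have "(\<integral>\<omega>. (\<xi> k \<omega>)\<^sup>2 \<partial>M) = v * h\<^sup>2 - 2 * c * h * (c * h) + (c * h)\<^sup>2" for k
    unfolding sq using int_sq[of k] int_4[of k] by (simp add: exp2 exp4 prob_space)
  then have "(\<integral>\<omega>. (\<xi> k \<omega>)\<^sup>2 \<partial>M) = v * h\<^sup>2 - (c * h)\<^sup>2" for k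
    by (simp add: power2_eq_square)
  then have var: "(\<integral>\<omega>. \<xi> k \<omega> * \<xi> k \<omega> \<partial>M) \<le> v * h\<^sup>2" for k
    by (simp add: power2_eq_square)
  have prod: "integrable M (\<lambda>\<omega>. \<xi> k \<omega> * \<xi> l \<omega>) \<and> (\<integral>\<omega>. \<xi> k \<omega> * \<xi> l \<omega> \<partial>M) = 0"
    if "k \<noteq> l" for k l
  proof -
    have "indep_vars (\<lambda>_. borel) \<xi> {k, l}" by (rule indep_vars_subset[OF indep]) auto
    from indep_vars_integrable[OF _ this] indep_vars_lebesgue_integral[OF _ this] int_\<xi> that mean
    show ?thesis by auto
  qed
  have expand: "(\<Sum>k<N. \<xi> k \<omega>)\<^sup>2 = (\<Sum>k<N. \<Sum>l<N. \<xi> k \<omega> * \<xi> l \<omega>)" for \<omega>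
    by (simp add: power2_eq_square sum_product)
  have int_prod: "integrable M (\<lambda>\<omega>. \<xi> k \<omega> * \<xi> l \<omega>)" for k l
    using prod[of k l] int_\<xi>2[of k] by (cases "k = l") (auto simp: power2_eq_square)
  show "integrable M (\<lambda>\<omega>. (\<Sum>k<N. \<xi> k \<omega>)\<^sup>2)"
    unfolding expand by (intro Bochner_Integration.integrable_sum int_prod)
  have "(\<integral>\<omega>. (\<Sum>k<N. \<xi> k \<omega>)\<^sup>2 \<partial>M) = (\<Sum>k<N. \<Sum>l<N. \<integral>\<omega>. \<xi> k \<omega> * \<xi> l \<omega> \<partial>M)"
    unfolding expand by (simp add: int_prod)
  also have "\<dots> = (\<Sum>k<N. \<Sum>l<N. if l = k then (\<integral>\<omega>. \<xi> k \<omega> * \<xi> k \<omega> \<partial>M) else 0)"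
    using prod by (intro sum.cong refl) auto
  also have "\<dots> = (\<Sum>k<N. \<integral>\<omega>. \<xi> k \<omega> * \<xi> k \<omega> \<partial>M)" by simp
  also have "\<dots> \<le> (\<Sum>k<N. v * h\<^sup>2)" by (intro sum_mono var)
  finally show "(\<integral>\<omega>. (\<Sum>k<N. \<xi> k \<omega>)\<^sup>2 \<partial>M) \<le> real N * v * h\<^sup>2" by simp
qed

text \<open>The mixed terms in the expansion of the square vanish, since the event \<open>B\<close> and the increments
  up to a partition point belong to the past of the next increment.\<close>
lemma incr_sq_telescope:
  assumes s: "0 \<le> s" and h: "0 < h" and B: "B \<in> sets (F s)"
  shows "(\<integral>\<omega>. indicator B \<omega> * (incr i s (s + real N * h) \<omega>)\<^sup>2 \<partial>M) =
    (\<Sum>k<N. \<integral>\<omega>. indicator B \<omega> * (incr i (s + real k * h) (s + real (Suc k) * h) \<omega>)\<^sup>2 \<partial>M)"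
proof (induction N)
  case (Suc n)
  let ?a = "s + real n * h" let ?b = "s + real (Suc n) * h"
  have ab: "s \<le> ?a" "0 \<le> ?a" "?a \<le> ?b" "s \<le> ?b" using s h by (auto simp: algebra_simps)
  have BM[measurable]: "B \<in> sets M" using B subalg by (auto simp: subalgebra_def)
  let ?H = "\<lambda>\<omega>. indicator B \<omega> * incr i s ?a \<omega>"
  have "indicator B \<in> borel_measurable (F ?a)"
    using B sets_mono[OF ab(1)] by auto
  then have H: "?H \<in> borel_measurable (F ?a)"
    by (intro borel_measurable_times borel_measurable_diff component_F s ab order_refl)
  note I = incr_sq_integrable[OF s ab(1), of i] incr_sq_integrable[OF ab(2,3), of i]
  have intB: "integrable M (\<lambda>\<omega>. indicator B \<omega> * f \<omega>)" if "integrable M f" for f :: "'a \<Rightarrow> real"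
    using integrable_real_mult_indicator[OF BM that] by (simp add: mult.commute)
  have "integrable M (\<lambda>\<omega>. incr i s ?a \<omega> * incr i ?a ?b \<omega>)"
    by (intro sq_integrable_mult I incr_M s ab)
  from intB[OF this] have int_cross: "integrable M (\<lambda>\<omega>. ?H \<omega> * incr i ?a ?b \<omega>)"
    by (simp add: mult.assoc)
  have "(\<integral>\<omega>. indicator B \<omega> * (incr i s ?b \<omega>)\<^sup>2 \<partial>M) =
      (\<integral>\<omega>. indicator B \<omega> * (incr i s ?a \<omega>)\<^sup>2 + 2 * (?H \<omega> * incr i ?a ?b \<omega>)
        + indicator B \<omega> * (incr i ?a ?b \<omega>)\<^sup>2 \<partial>M)"
    by (intro Bochner_Integration.integral_cong refl) (simp only: power2_eq_square, algebra)
  also have "\<dots> = (\<integral>\<omega>. indicator B \<omega> * (incr i s ?a \<omega>)\<^sup>2 \<partial>M)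
      + 2 * (\<integral>\<omega>. ?H \<omega> * incr i ?a ?b \<omega> \<partial>M) + (\<integral>\<omega>. indicator B \<omega> * (incr i ?a ?b \<omega>)\<^sup>2 \<partial>M)"
    using intB[OF I(1)] intB[OF I(2)] int_cross by simp
  also have "(\<integral>\<omega>. ?H \<omega> * incr i ?a ?b \<omega> \<partial>M) = 0"
    by (rule incr_orthogonal[OF ab(2,3) H int_cross])
  finally show ?case using Suc.IH by simp
qed simp

text \<open>The increments are not known to be independent of \<open>F s\<close>, only orthogonal to it. Orthogonality
  permits a refinement of the partition without a change of the left-hand side, and along fine
  partitions the sum of squares converges to the deterministic quadratic variation \<open>c (t - s)\<close>
  in mean square, where the event \<open>B\<close> factors out.\<close>
lemma conditional_second_moment:
  obtains c where "0 \<le> c" and "\<And>s t B. 0 \<le> s \<Longrightarrow> s < t \<Longrightarrow> B \<in> sets (F s) \<Longrightarrow>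
    (\<integral>\<omega>. indicator B \<omega> * (incr i s t \<omega>)\<^sup>2 \<partial>M) = c * (t - s) * prob B"
proof -
  obtain c v where c0: "0 \<le> c"
    and int4: "\<And>s t. 0 \<le> s \<Longrightarrow> s < t \<Longrightarrow> integrable M (\<lambda>\<omega>. (incr i s t \<omega>) ^ 4)"
    and c: "\<And>s t. 0 \<le> s \<Longrightarrow> s < t \<Longrightarrow> (\<integral>\<omega>. (incr i s t \<omega>)\<^sup>2 \<partial>M) = c * (t - s)"
    and v: "\<And>s t. 0 \<le> s \<Longrightarrow> s < t \<Longrightarrow> (\<integral>\<omega>. (incr i s t \<omega>) ^ 4 \<partial>M) = v * (t - s)\<^sup>2"
    by (rule brownian_increment_moments[OF brownian pos_def, of i, unfolded vector_minus_component])
       (rule that; assumption)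
  show ?thesis
  proof
    fix s t B assume s: "0 \<le> s" and st: "s < t" and B: "B \<in> sets (F s)"
    have BM[measurable]: "B \<in> sets M" using B subalg by (auto simp: subalgebra_def)
    define T where "T = t - s"
    have T: "0 < T" "t = s + T" using st by (auto simp: T_def)
    let ?E = "\<integral>\<omega>. indicator B \<omega> * (incr i s t \<omega>)\<^sup>2 \<partial>M"
    have bound: "\<bar>?E - c * T * prob B\<bar> \<le> \<epsilon> + v * T\<^sup>2 / \<epsilon> * (1 / real (Suc n))" if "\<epsilon> > 0" for \<epsilon> n
    proof -
      define N where "N = Suc n"
      define h where "h = T / real N"
      have N: "real N > 0" by (simp add: N_def)
      have h: "0 < h" "real N * h = T" using T N by (auto simp: h_def)
      define \<xi> where "\<xi> = (\<lambda>k \<omega>. (incr i (s + real k * h) (s + real (Suc k) * h) \<omega>)\<^sup>2 - c * h)"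
      define S where "S = (\<lambda>\<omega>. \<Sum>k<N. \<xi> k \<omega>)"
      have S2: "integrable M (\<lambda>\<omega>. (S \<omega>)\<^sup>2)" "(\<integral>\<omega>. (S \<omega>)\<^sup>2 \<partial>M) \<le> real N * v * h\<^sup>2"
        unfolding S_def \<xi>_def
        by (rule sum_of_centred_squares(1)[OF c int4 v s h(1)], assumption+)
           (rule sum_of_centred_squares(2)[OF c int4 v s h(1)], assumption+)
      have int_sq: "integrable M (\<lambda>\<omega>. (incr i (s + real k * h) (s + real (Suc k) * h) \<omega>)\<^sup>2)" for k
        using s h by (intro incr_sq_integrable) (auto simp: algebra_simps)
      then have int_\<xi>: "integrable M (\<xi> k)" for k unfolding \<xi>_def by simp
      have int_S: "integrable M S" unfolding S_def by (intro Bochner_Integration.integrable_sum int_\<xi>)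
      have intB: "integrable M (\<lambda>\<omega>. indicator B \<omega> * f \<omega>)" if "integrable M f" for f :: "'a \<Rightarrow> real"
        using integrable_real_mult_indicator[OF BM that] by (simp add: mult.commute)
      have "?E = (\<Sum>k<N. \<integral>\<omega>. indicator B \<omega> * (incr i (s + real k * h) (s + real (Suc k) * h) \<omega>)\<^sup>2 \<partial>M)"
        using incr_sq_telescope[OF s h(1) B, where i = i and N = N] h(2) T(2) by simp
      also have "\<dots> = (\<integral>\<omega>. (\<Sum>k<N. indicator B \<omega> * (incr i (s + real k * h) (s + real (Suc k) * h) \<omega>)\<^sup>2) \<partial>M)"
        by (rule Bochner_Integration.integral_sum[symmetric]) (intro intB int_sq)
      also have "\<dots> = (\<integral>\<omega>. indicator B \<omega> * S \<omega> + indicator B \<omega> * (c * T) \<partial>M)"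
        unfolding S_def \<xi>_def
        by (intro Bochner_Integration.integral_cong refl)
           (simp add: sum_distrib_left sum_subtractf right_diff_distrib h(2)[symmetric])
      also have "\<dots> = (\<integral>\<omega>. indicator B \<omega> * S \<omega> \<partial>M) + c * T * prob B"
        using intB[OF int_S] intB[of "\<lambda>_. c * T"] BM
        by (subst Bochner_Integration.integral_add) (auto simp: emeasure_eq_measure)
      finally have "\<bar>?E - c * T * prob B\<bar> = \<bar>\<integral>\<omega>. indicator B \<omega> * S \<omega> \<partial>M\<bar>" by simp
      also have "\<dots> \<le> (\<integral>\<omega>. \<bar>indicator B \<omega> * S \<omega>\<bar> \<partial>M)"
        by (rule integral_abs_bound)
      also have "\<dots> \<le> (\<integral>\<omega>. \<epsilon> + (S \<omega>)\<^sup>2 / \<epsilon> \<partial>M)"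
      proof (rule integral_mono)
        fix \<omega>
        \<comment> \<open>Weighted arithmetic-geometric mean inequality; \<open>\<epsilon>\<close> is sent to zero only after \<open>n \<rightarrow> \<infinity>\<close>.\<close>
        have "0 \<le> (\<bar>S \<omega>\<bar> - \<epsilon>)\<^sup>2 + \<bar>S \<omega>\<bar> * \<epsilon>" using that by simp
        then have "\<bar>S \<omega>\<bar> * \<epsilon> \<le> \<epsilon> * \<epsilon> + (S \<omega>)\<^sup>2" by (simp add: power2_eq_square algebra_simps)
        then have "\<bar>S \<omega>\<bar> \<le> \<epsilon> + (S \<omega>)\<^sup>2 / \<epsilon>" using that by (simp add: field_simps)
        moreover have "\<bar>indicator B \<omega> * S \<omega>\<bar> \<le> \<bar>S \<omega>\<bar>"
          by (auto simp: indicator_def)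
        ultimately show "\<bar>indicator B \<omega> * S \<omega>\<bar> \<le> \<epsilon> + (S \<omega>)\<^sup>2 / \<epsilon>" by simp
      qed (use S2(1) intB[OF int_S] in auto)
      also have "\<dots> = \<epsilon> + (\<integral>\<omega>. (S \<omega>)\<^sup>2 \<partial>M) / \<epsilon>"
        using S2(1) by (simp add: prob_space)
      also have "\<dots> \<le> \<epsilon> + (real N * v * h\<^sup>2) / \<epsilon>"
        using S2(2) that by (simp add: divide_right_mono)
      also have "\<dots> = \<epsilon> + v * T\<^sup>2 / \<epsilon> * (1 / real N)"
        using N by (simp add: h_def power2_eq_square field_simps)
      finally show ?thesis by (simp add: N_def)
    qed
    have "\<bar>?E - c * T * prob B\<bar> \<le> 0 + \<epsilon>" if "\<epsilon> > 0" for \<epsilon>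
    proof -
      have "(\<lambda>n. \<epsilon> + v * T\<^sup>2 / \<epsilon> * (1 / real (Suc n))) \<longlonglongrightarrow> \<epsilon> + v * T\<^sup>2 / \<epsilon> * 0"
        by (intro tendsto_intros LIMSEQ_Suc[OF lim_1_over_n])
      then show ?thesis
        using bound[OF that] LIMSEQ_le_const by fastforce
    qed
    then have "\<bar>?E - c * T * prob B\<bar> \<le> 0" by (rule field_le_epsilon)
    then show "?E = c * (t - s) * prob B" by (simp add: T_def)
  qed (fact c0)
qed

text \<open>The discrete stochastic integral of the integrand that equals \<open>G k\<close> on the event \<open>B k\<close> and
  vanishes elsewhere. Stopping is encoded by a decreasing family \<open>B\<close>.\<close>
definition transform :: "(nat \<Rightarrow> 'a set) \<Rightarrow> (nat \<Rightarrow> 'a \<Rightarrow> real^'n) \<Rightarrow> real \<Rightarrow> nat \<Rightarrow> 'a \<Rightarrow> real" where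
  "transform B G h n \<omega> =
     (\<Sum>k<n. indicator (B k) \<omega> * (G k \<omega> \<bullet> (W (real (Suc k) * h) \<omega> - W (real k * h) \<omega>)))"

text \<open>The upper bound in the isometry of stochastic integrals, in discrete time. The constant is uniform in the mesh, the
  integrand and the events, so that it survives the refinement of the grid.\<close>
lemma transform_bounds:
  "\<exists>C\<ge>0. \<forall>h>0. \<forall>K G B n.
      (\<forall>k i. (\<lambda>\<omega>. G k \<omega> $ i) \<in> borel_measurable (F (real k * h))) \<longrightarrow>
      (\<forall>k \<omega>. norm (G k \<omega>) \<le> K) \<longrightarrow> (\<forall>k. B k \<in> sets (F (real k * h))) \<longrightarrow>
      transform B G h n \<in> borel_measurable (F (real n * h)) \<and>
      integrable M (\<lambda>\<omega>. (transform B G h n \<omega>)\<^sup>2) \<and>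
      (\<integral>\<omega>. transform B G h n \<omega> \<partial>M) = 0 \<and>
      (\<integral>\<omega>. (transform B G h n \<omega>)\<^sup>2 \<partial>M) \<le> C * K\<^sup>2 * h * (\<Sum>k<n. prob (B k))"
proof -
  define P where "P = (\<lambda>i c. 0 \<le> c \<and> (\<forall>s t B. 0 \<le> s \<longrightarrow> s < t \<longrightarrow> B \<in> sets (F s) \<longrightarrow>
      (\<integral>\<omega>. indicator B \<omega> * (incr i s t \<omega>)\<^sup>2 \<partial>M) = c * (t - s) * prob B))"
  have "\<exists>c. P i c" for i
  proof (rule conditional_second_moment[of i])
    fix c assume "0 \<le> c" "\<And>s t B. 0 \<le> s \<Longrightarrow> s < t \<Longrightarrow> B \<in> sets (F s) \<Longrightarrow>
      (\<integral>\<omega>. indicator B \<omega> * (incr i s t \<omega>)\<^sup>2 \<partial>M) = c * (t - s) * prob B"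
    then have "P i c" unfolding P_def by (intro conjI allI impI)
    then show ?thesis by (rule exI)
  qed
  then have "\<forall>i. \<exists>c. P i c" by (rule allI)
  from choice[OF this] obtain c where Pc: "\<forall>i. P i (c i)" by (rule exE)
  have c0: "0 \<le> c i" for i using Pc unfolding P_def by (rule allE) (erule conjunct1)
  have c: "(\<integral>\<omega>. indicator B \<omega> * (incr i s t \<omega>)\<^sup>2 \<partial>M) = c i * (t - s) * prob B"
    if "0 \<le> s" "s < t" "B \<in> sets (F s)" for i s t B
    using Pc[unfolded P_def, rule_format, THEN conjunct2, rule_format, OF that] .
  define C where "C = (\<Sum>i\<in>UNIV. c i)"
  have step: "transform B G h n \<in> borel_measurable (F (real n * h)) \<and>
      integrable M (\<lambda>\<omega>. (transform B G h n \<omega>)\<^sup>2) \<and>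
      (\<integral>\<omega>. transform B G h n \<omega> \<partial>M) = 0 \<and>
      (\<integral>\<omega>. (transform B G h n \<omega>)\<^sup>2 \<partial>M) \<le> C * K\<^sup>2 * h * (\<Sum>k<n. prob (B k))"
    if h: "0 < h" and G: "\<And>k i. (\<lambda>\<omega>. G k \<omega> $ i) \<in> borel_measurable (F (real k * h))"
      and K: "\<And>k \<omega>. norm (G k \<omega>) \<le> K" and B: "\<And>k. B k \<in> sets (F (real k * h))"
    for h K G B n
  proof (induction n)
    case 0
    then show ?case by (simp add: transform_def)
  next
    case (Suc n)
    define a where "a = real n * h"
    define b where "b = real (Suc n) * h"
    have ab: "0 \<le> a" "a < b" "a \<le> b" "0 \<le> b" "b - a = h" using h by (auto simp: a_def b_def algebra_simps)
    define T where "T = transform B G h n"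
    define E where "E = (\<lambda>i \<omega>. indicator (B n) \<omega> * G n \<omega> $ i :: real)"
    define D where "D = (\<lambda>\<omega>. \<Sum>i\<in>UNIV. E i \<omega> * incr i a b \<omega>)"
    have T: "T \<in> borel_measurable (F a)" "integrable M (\<lambda>\<omega>. (T \<omega>)\<^sup>2)" "(\<integral>\<omega>. T \<omega> \<partial>M) = 0"
      "(\<integral>\<omega>. (T \<omega>)\<^sup>2 \<partial>M) \<le> C * K\<^sup>2 * h * (\<Sum>k<n. prob (B k))"
      using Suc.IH by (simp_all add: T_def a_def)
    have TM: "T \<in> borel_measurable M" by (rule measurable_from_F[OF T(1)])
    have split: "transform B G h (Suc n) = (\<lambda>\<omega>. T \<omega> + D \<omega>)"
      by (simp add: fun_eq_iff transform_def T_def D_def E_def a_def b_def inner_vec_def sum_distrib_left mult.assoc)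
    have Ba: "B n \<in> sets (F a)" using B[of n] by (simp add: a_def)
    then have BM: "B n \<in> sets M" using subalg by (auto simp: subalgebra_def)
    have E: "E i \<in> borel_measurable (F a)" for i
      unfolding E_def using G[of n i, folded a_def] Ba by (intro borel_measurable_times) auto
    have Eb: "\<bar>E i \<omega>\<bar> \<le> K" for i \<omega>
    proof -
      have "\<bar>E i \<omega>\<bar> \<le> \<bar>G n \<omega> $ i\<bar>" by (auto simp: E_def indicator_def)
      also have "\<dots> \<le> norm (G n \<omega>)" by (rule component_le_norm_cart)
      also have "\<dots> \<le> K" by (rule K)
      finally show ?thesis .
    qed
    have EM: "E i \<in> borel_measurable M" for i by (rule measurable_from_F[OF E])
    note iM = incr_M[OF ab(1,3)] and i2 = incr_sq_integrable[OF ab(1,3)]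
    have Db: "D \<in> borel_measurable (F b)"
      unfolding D_def
      by (intro borel_measurable_sum borel_measurable_times borel_measurable_diff component_F
          measurable_F_mono[OF ab(3) E] ab order_refl)
    have DM: "D \<in> borel_measurable M" by (rule measurable_from_F[OF Db])
    have intB: "integrable M (\<lambda>\<omega>. indicator (B n) \<omega> * f \<omega>)" if "integrable M f" for f :: "'a \<Rightarrow> real"
      using integrable_real_mult_indicator[OF BM that] by (simp add: mult.commute)
    have D2_le: "(D \<omega>)\<^sup>2 \<le> K\<^sup>2 * (\<Sum>i\<in>UNIV. indicator (B n) \<omega> * (incr i a b \<omega>)\<^sup>2)" for \<omega>
    proof -
      have "D \<omega> = indicator (B n) \<omega> * (G n \<omega> \<bullet> (W b \<omega> - W a \<omega>))"
        by (simp add: D_def E_def inner_vec_def sum_distrib_left mult.assoc)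
      then have "(D \<omega>)\<^sup>2 = indicator (B n) \<omega> * (G n \<omega> \<bullet> (W b \<omega> - W a \<omega>))\<^sup>2"
        by (simp add: power_mult_distrib indicator_def)
      also have "\<dots> \<le> indicator (B n) \<omega> * (K\<^sup>2 * (norm (W b \<omega> - W a \<omega>))\<^sup>2)"
      proof (rule mult_left_mono)
        have "\<bar>G n \<omega> \<bullet> (W b \<omega> - W a \<omega>)\<bar> \<le> norm (G n \<omega>) * norm (W b \<omega> - W a \<omega>)"
          by (rule Cauchy_Schwarz_ineq2)
        also have "\<dots> \<le> K * norm (W b \<omega> - W a \<omega>)" by (intro mult_right_mono K) simp
        finally show "(G n \<omega> \<bullet> (W b \<omega> - W a \<omega>))\<^sup>2 \<le> K\<^sup>2 * (norm (W b \<omega> - W a \<omega>))\<^sup>2"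
          by (metis abs_ge_zero power2_abs power_mono power_mult_distrib)
      qed simp
      also have "\<dots> = K\<^sup>2 * (\<Sum>i\<in>UNIV. indicator (B n) \<omega> * (incr i a b \<omega>)\<^sup>2)"
        unfolding power2_norm_eq_inner inner_vec_def
        by (simp add: power2_eq_square sum_distrib_left mult_ac)
      finally show ?thesis .
    qed
    have int_bd: "integrable M (\<lambda>\<omega>. K\<^sup>2 * (\<Sum>i\<in>UNIV. indicator (B n) \<omega> * (incr i a b \<omega>)\<^sup>2))"
      by (intro integrable_mult_right Bochner_Integration.integrable_sum intB i2)
    have D2: "integrable M (\<lambda>\<omega>. (D \<omega>)\<^sup>2)"
    proof (rule Bochner_Integration.integrable_bound[OF int_bd])
      show "(\<lambda>\<omega>. (D \<omega>)\<^sup>2) \<in> borel_measurable M" using DM by simp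
      show "AE \<omega> in M. norm ((D \<omega>)\<^sup>2)
          \<le> norm (K\<^sup>2 * (\<Sum>i\<in>UNIV. indicator (B n) \<omega> * (incr i a b \<omega>)\<^sup>2))"
        unfolding real_norm_def abs_power2 by (intro AE_I2 order_trans[OF D2_le abs_ge_self])
    qed
    have "(\<integral>\<omega>. (D \<omega>)\<^sup>2 \<partial>M) \<le> (\<integral>\<omega>. K\<^sup>2 * (\<Sum>i\<in>UNIV. indicator (B n) \<omega> * (incr i a b \<omega>)\<^sup>2) \<partial>M)"
      by (rule integral_mono[OF D2 int_bd D2_le])
    also have "\<dots> = K\<^sup>2 * (\<Sum>i\<in>UNIV. \<integral>\<omega>. indicator (B n) \<omega> * (incr i a b \<omega>)\<^sup>2 \<partial>M)"
      by (subst integral_mult_right_zero, subst Bochner_Integration.integral_sum) (rule intB[OF i2], rule refl)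
    also have "\<dots> = C * K\<^sup>2 * h * prob (B n)"
      by (simp add: c[OF ab(1,2) Ba] ab(5) C_def sum_distrib_right sum_distrib_left mult_ac)
    finally have varD: "(\<integral>\<omega>. (D \<omega>)\<^sup>2 \<partial>M) \<le> C * K\<^sup>2 * h * prob (B n)" .
    \<comment> \<open>Used twice: with \<open>H = 1\<close> for the mean and with \<open>H = T\<close> for the mixed term.\<close>
    have ortho: "integrable M (\<lambda>\<omega>. H \<omega> * D \<omega>) \<and> (\<integral>\<omega>. H \<omega> * D \<omega> \<partial>M) = 0"
      if H: "H \<in> borel_measurable (F a)" "integrable M (\<lambda>\<omega>. (H \<omega>)\<^sup>2)" for H
    proof -
      have HM: "H \<in> borel_measurable M" by (rule measurable_from_F[OF H(1)])
      have HE: "(\<lambda>\<omega>. H \<omega> * E i \<omega>) \<in> borel_measurable (F a)" for i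
        by (intro borel_measurable_times H E)
      have HE2: "integrable M (\<lambda>\<omega>. (H \<omega> * E i \<omega>)\<^sup>2)" for i
      proof (rule Bochner_Integration.integrable_bound)
        show "integrable M (\<lambda>\<omega>. K\<^sup>2 * (H \<omega>)\<^sup>2)" using H(2) by simp
        have "(E i \<omega>)\<^sup>2 \<le> K\<^sup>2" for \<omega>
          using power_mono[OF Eb[of i \<omega>], of 2] by simp
        then have "(H \<omega> * E i \<omega>)\<^sup>2 \<le> K\<^sup>2 * (H \<omega>)\<^sup>2" for \<omega>
          unfolding power_mult_distrib mult.commute[of "K\<^sup>2"] by (intro mult_left_mono) auto
        then show "AE \<omega> in M. norm ((H \<omega> * E i \<omega>)\<^sup>2) \<le> norm (K\<^sup>2 * (H \<omega>)\<^sup>2)" by simp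
      qed (use measurable_from_F[OF HE] in simp)
      have int: "integrable M (\<lambda>\<omega>. H \<omega> * E i \<omega> * incr i a b \<omega>)" for i
        by (rule sq_integrable_mult[OF measurable_from_F[OF HE] iM HE2 i2])
      have eq: "H \<omega> * D \<omega> = (\<Sum>i\<in>UNIV. H \<omega> * E i \<omega> * incr i a b \<omega>)" for \<omega>
        by (simp add: D_def sum_distrib_left mult.assoc)
      have "integrable M (\<lambda>\<omega>. H \<omega> * D \<omega>)"
        unfolding eq by (intro Bochner_Integration.integrable_sum int)
      moreover have "(\<integral>\<omega>. H \<omega> * D \<omega> \<partial>M) = 0"
        unfolding eq using int incr_orthogonal[OF ab(1,3) HE int]
        by (simp add: Bochner_Integration.integral_sum)
      ultimately show ?thesis by simp
    qed
    have T1: "integrable M T" using sq_integrable_mult[OF TM _ T(2), of "\<lambda>_. 1"] by simp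
    have eD: "integrable M D" "(\<integral>\<omega>. D \<omega> \<partial>M) = 0" using ortho[of "\<lambda>_. 1"] by auto
    note TD = ortho[OF T(1,2)]
    have sq: "(T \<omega> + D \<omega>)\<^sup>2 = (T \<omega>)\<^sup>2 + 2 * (T \<omega> * D \<omega>) + (D \<omega>)\<^sup>2" for \<omega>
      by (simp add: power2_eq_square algebra_simps)
    have "(\<integral>\<omega>. (T \<omega> + D \<omega>)\<^sup>2 \<partial>M) = (\<integral>\<omega>. (T \<omega>)\<^sup>2 \<partial>M) + (\<integral>\<omega>. (D \<omega>)\<^sup>2 \<partial>M)"
      unfolding sq using T(2) TD D2 by simp
    also have "\<dots> \<le> C * K\<^sup>2 * h * (\<Sum>k<Suc n. prob (B k))"
      using T(4) varD by (simp add: algebra_simps)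
    finally have "(\<integral>\<omega>. (T \<omega> + D \<omega>)\<^sup>2 \<partial>M) \<le> C * K\<^sup>2 * h * (\<Sum>k<Suc n. prob (B k))" .
    moreover have "integrable M (\<lambda>\<omega>. (T \<omega> + D \<omega>)\<^sup>2)"
      unfolding sq using T(2) TD D2 by simp
    moreover have "(\<integral>\<omega>. T \<omega> + D \<omega> \<partial>M) = 0"
      using T1 T(3) eD by simp
    moreover have "(\<lambda>\<omega>. T \<omega> + D \<omega>) \<in> borel_measurable (F (real (Suc n) * h))"
      unfolding b_def[symmetric]
      by (intro borel_measurable_add Db measurable_F_mono[OF ab(3) T(1)])
    ultimately show ?case unfolding split by blast
  qed
  have "0 \<le> C" unfolding C_def by (intro sum_nonneg c0)
  then show ?thesis
    by (intro exI[of _ C] conjI[of "0 \<le> C"] allI impI step) (simp_all only:)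
qed

end

section \<open>Switching functionals along a path\<close>

text \<open>The number of switches before grid time \<open>k h\<close>. A switch to the next coordinate of the cycle is
  recorded when the pushing process \<open>y\<close> of that coordinate has grown over the last step. Growth of
  \<open>y\<close>, rather than a zero of the reflected path, is tested because only the values of \<open>y\<close> at grid
  times enter, which makes the count adapted.\<close>
primrec switch_count :: "(nat \<Rightarrow> 'n) \<Rightarrow> (real \<Rightarrow> real^'n) \<Rightarrow> real \<Rightarrow> nat \<Rightarrow> nat" where
  "switch_count cyc y h 0 = 0"
| "switch_count cyc y h (Suc k) =
    (if y (real k * h) $ cyc (Suc (switch_count cyc y h k))
        < y (real (Suc k) * h) $ cyc (Suc (switch_count cyc y h k))
     then Suc (switch_count cyc y h k) else switch_count cyc y h k)"

text \<open>While \<open>g (cyc n)\<close> is active, each pushing direction other than that of the next coordinate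
  \<open>cyc (Suc n)\<close> is harmless, and the hand-over to the next functional loses at most a multiple of
  the next coordinate, which is zero at an ideal switching time.\<close>
locale switching_functionals =
  fixes \<theta> :: "real^'n" and R :: "real^'n^'n" and g :: "'n \<Rightarrow> real^'n"
    and cyc :: "nat \<Rightarrow> 'n" and p :: nat and V :: real
  assumes drift_zero: "g j \<bullet> \<theta> = 0"
    and push_nonneg: "j \<noteq> cyc (Suc n) \<Longrightarrow> 0 \<le> g (cyc n) \<bullet> column j R"
    and switch_gain: "z \<in> nonneg_orthant \<Longrightarrow>
      g (cyc n) \<bullet> z - V * z $ cyc (Suc n) \<le> g (cyc (Suc n)) \<bullet> z"
    and V_nonneg: "0 \<le> V"
    and cycle: "\<exists>l<p. cyc (n + l) = j"

lemma column_decomposition: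
  fixes R :: "real^'n^'m"
  shows "a \<bullet> (R *v v) = (\<Sum>j\<in>UNIV. v $ j * (a \<bullet> column j R))"
  by (simp add: matrix_mult_sum scalar_mult_eq_scaleR inner_sum_right)

locale switching_path = switching_functionals \<theta> R g cyc p V
  for \<theta> :: "real^'n" and R :: "real^'n^'n" and g cyc p V +
  fixes z y w :: "real \<Rightarrow> real^'n"
  assumes skorokhod: "0 \<le> t \<Longrightarrow> z t = w t + t *\<^sub>R \<theta> + R *v y t"
    and cont_z: "continuous_on {0..} z" and cont_y: "continuous_on {0..} y"
    and in_orthant: "0 \<le> t \<Longrightarrow> z t \<in> nonneg_orthant"
    and y_mono: "mono_on {0..} (\<lambda>t. y t $ j)"
    and complementary: "0 \<le> a \<Longrightarrow> a \<le> b \<Longrightarrow> y a $ j < y b $ j \<Longrightarrow> \<exists>s\<in>{a..b}. z s $ j = 0"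
begin

abbreviation active :: "real \<Rightarrow> nat \<Rightarrow> real^'n" where
  "active h k \<equiv> g (cyc (switch_count cyc y h k))"

lemma y_le: "0 \<le> a \<Longrightarrow> a \<le> b \<Longrightarrow> y a $ j \<le> y b $ j"
  using y_mono[of j] by (auto simp: mono_on_def)

text \<open>Balance over one grid step. Without a switch the dangerous pushing component is constant; with a
  switch it has grown by at most \<open>\<mu>\<close> and its coordinate has a zero nearby, so both losses are of
  order \<open>\<mu>\<close>.\<close>
lemma active_step:
  assumes h: "0 < h" and D: "\<And>i j. - D \<le> g i \<bullet> column j R" "0 \<le> D" and \<mu>: "0 \<le> \<mu>"
    and osc: "\<And>s t. real k * h \<le> s \<Longrightarrow> s \<le> t \<Longrightarrow> t \<le> real (Suc k) * h \<Longrightarrow>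
      norm (z t - z s) \<le> \<mu> \<and> norm (y t - y s) \<le> \<mu>"
  shows "active h k \<bullet> z (real k * h) + active h k \<bullet> (w (real (Suc k) * h) - w (real k * h))
      - real (switch_count cyc y h (Suc k) - switch_count cyc y h k) * ((V + D) * \<mu>)
    \<le> active h (Suc k) \<bullet> z (real (Suc k) * h)"
proof -
  define a where "a = real k * h"
  define b where "b = real (Suc k) * h"
  define c where "c = switch_count cyc y h k"
  define j' where "j' = cyc (Suc c)"
  have ab: "0 \<le> a" "0 \<le> b" "a \<le> b" using h by (auto simp: a_def b_def algebra_simps)
  note osc' = osc[folded a_def b_def]
  have y0: "0 \<le> y b $ j - y a $ j" for j using y_le[OF ab(1,3)] by simp
  have y\<mu>: "y b $ j - y a $ j \<le> \<mu>" for j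
    using component_le_norm_cart[of "y b - y a" j] osc'[of a b] ab(3)
    unfolding vector_minus_component by linarith
  define S where "S = (\<Sum>j\<in>UNIV. (y b $ j - y a $ j) * (g (cyc c) \<bullet> column j R))"
  have "z b - z a = (w b - w a) + (b - a) *\<^sub>R \<theta> + R *v (y b - y a)"
    using skorokhod[OF ab(1)] skorokhod[OF ab(2)]
    by (simp add: algebra_simps matrix_vector_mult_diff_distrib)
  then have "g (cyc c) \<bullet> (z b - z a) = g (cyc c) \<bullet> (w b - w a) + g (cyc c) \<bullet> (R *v (y b - y a))"
    by (simp add: inner_add_right drift_zero)
  then have dz: "g (cyc c) \<bullet> z b = g (cyc c) \<bullet> z a + g (cyc c) \<bullet> (w b - w a) + S"
    by (simp add: column_decomposition S_def inner_diff_right)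
  have rest: "0 \<le> (\<Sum>j\<in>UNIV - {j'}. (y b $ j - y a $ j) * (g (cyc c) \<bullet> column j R))"
    by (intro sum_nonneg mult_nonneg_nonneg y0 push_nonneg) (auto simp: j'_def)
  have S: "S = (y b $ j' - y a $ j') * (g (cyc c) \<bullet> column j' R)
      + (\<Sum>j\<in>UNIV - {j'}. (y b $ j - y a $ j) * (g (cyc c) \<bullet> column j R))"
    unfolding S_def by (rule sum.remove) auto
  show ?thesis
  proof (cases "y a $ j' < y b $ j'")
    case False
    then have "switch_count cyc y h (Suc k) = c"
      by (simp only: switch_count.simps c_def[symmetric] a_def[symmetric] b_def[symmetric] j'_def[symmetric] if_False)
    moreover have "y b $ j' - y a $ j' = 0" using False y0[of j'] by simp
    then have "0 \<le> S" using rest S by simp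
    ultimately show ?thesis using dz by (simp add: a_def b_def c_def)
  next
    case True
    then have c': "switch_count cyc y h (Suc k) = Suc c"
      by (simp only: switch_count.simps c_def[symmetric] a_def[symmetric] b_def[symmetric] j'_def[symmetric] if_True)
    obtain s where s: "s \<in> {a..b}" "z s $ j' = 0"
      using complementary[OF ab(1,3) True] by blast
    have zb: "z b $ j' \<le> \<mu>"
      using component_le_norm_cart[of "z b - z s" j'] osc'[of s b] s
      unfolding vector_minus_component atLeastAtMost_iff by linarith
    have "- (D * \<mu>) \<le> (y b $ j' - y a $ j') * (- D)"
      using mult_right_mono[OF y\<mu>[of j'] D(2)] by (simp add: mult.commute)
    also have "\<dots> \<le> (y b $ j' - y a $ j') * (g (cyc c) \<bullet> column j' R)"
      by (intro mult_left_mono D y0)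
    finally have "- (D * \<mu>) \<le> S" using S rest by linarith
    moreover have "g (cyc c) \<bullet> z b - V * z b $ j' \<le> g (cyc (Suc c)) \<bullet> z b"
      unfolding j'_def by (rule switch_gain[OF in_orthant[OF ab(2)]])
    moreover have "V * z b $ j' \<le> V * \<mu>" by (rule mult_left_mono[OF zb V_nonneg])
    ultimately have "g (cyc c) \<bullet> z a + g (cyc c) \<bullet> (w b - w a) - (V + D) * \<mu> \<le> g (cyc (Suc c)) \<bullet> z b"
      using dz by (simp add: algebra_simps)
    then show ?thesis unfolding c' by (simp add: a_def b_def c_def)
  qed
qed

lemma switch_count_Suc:
  "switch_count cyc y h k \<le> switch_count cyc y h (Suc k)"
  "switch_count cyc y h (Suc k) \<le> Suc (switch_count cyc y h k)"
  by auto

text \<open>The count moves by unit steps, so it passes through each intermediate value.\<close>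
lemma switch_occurs:
  assumes "switch_count cyc y h a \<le> n" "n < switch_count cyc y h b" "a \<le> b"
  shows "\<exists>k\<ge>a. k < b \<and> switch_count cyc y h k = n \<and> switch_count cyc y h (Suc k) = Suc n"
  using assms(3,2)
proof (induction b rule: dec_induct)
  case base
  then show ?case using assms(1) by simp
next
  case (step b)
  show ?case
  proof (cases "n < switch_count cyc y h b")
    case True
    then show ?thesis using step.IH by (meson less_SucI)
  next
    case False
    then have "switch_count cyc y h b = n \<and> switch_count cyc y h (Suc b) = Suc n"
      using step.prems switch_count_Suc(2)[of h b] by simp
    then show ?thesis using step.hyps by blast
  qed
qed

lemma active_sum:
  assumes h: "0 < h" and D: "\<And>i j. - D \<le> g i \<bullet> column j R" "0 \<le> D" and \<mu>: "0 \<le> \<mu>"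
    and osc: "\<And>s t. 0 \<le> s \<Longrightarrow> s \<le> t \<Longrightarrow> t \<le> real n * h \<Longrightarrow> t \<le> s + h \<Longrightarrow>
      norm (z t - z s) \<le> \<mu> \<and> norm (y t - y s) \<le> \<mu>"
  shows "g (cyc 0) \<bullet> z 0 + (\<Sum>k<n. active h k \<bullet> (w (real (Suc k) * h) - w (real k * h)))
      - real (switch_count cyc y h n) * ((V + D) * \<mu>)
    \<le> active h n \<bullet> z (real n * h)"
proof -
  have "k \<le> n \<Longrightarrow> g (cyc 0) \<bullet> z 0 + (\<Sum>k<k. active h k \<bullet> (w (real (Suc k) * h) - w (real k * h)))
      - real (switch_count cyc y h k) * ((V + D) * \<mu>)
    \<le> active h k \<bullet> z (real k * h)" for k
  proof (induction k)
    case (Suc k)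
    let ?c = "switch_count cyc y h k" and ?c' = "switch_count cyc y h (Suc k)"
    have upto: "real (Suc k) * h \<le> real n * h"
      using h Suc.prems by (intro mult_right_mono) auto
    have "active h k \<bullet> z (real k * h) + active h k \<bullet> (w (real (Suc k) * h) - w (real k * h))
        - real (?c' - ?c) * ((V + D) * \<mu>) \<le> active h (Suc k) \<bullet> z (real (Suc k) * h)"
    proof (rule active_step[OF h D \<mu>])
      fix s t assume st: "real k * h \<le> s" "s \<le> t" "t \<le> real (Suc k) * h"
      moreover have "0 \<le> real k * h" using h by simp
      moreover have "real (Suc k) * h = real k * h + h" by (simp add: algebra_simps)
      ultimately show "norm (z t - z s) \<le> \<mu> \<and> norm (y t - y s) \<le> \<mu>"
        using upto by (intro osc) linarith+
    qed
    moreover have "real ?c' = real ?c + real (?c' - ?c)" using switch_count_Suc(1)[of h k] by simp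
    then have "real ?c' * ((V + D) * \<mu>) = real ?c * ((V + D) * \<mu>) + real (?c' - ?c) * ((V + D) * \<mu>)"
      by (simp only: distrib_right)
    moreover have "g (cyc 0) \<bullet> z 0 + (\<Sum>k<k. active h k \<bullet> (w (real (Suc k) * h) - w (real k * h)))
      - real ?c * ((V + D) * \<mu>) \<le> active h k \<bullet> z (real k * h)"
      using Suc by simp
    ultimately show ?case by (simp only: sum.lessThan_Suc)
  qed simp
  then show ?thesis by simp
qed

text \<open>The switches of a full cycle give each coordinate a zero. If they happen within a time in which
  the path barely moves, all coordinates are small simultaneously and the path is inside the unit
  ball. So outside the ball a block of \<open>q\<close> steps contains at most \<open>p\<close> switches.\<close>
lemma few_switches:
  assumes h: "0 < h"
    and osc: "\<And>s t. 0 \<le> s \<Longrightarrow> s \<le> t \<Longrightarrow> t \<le> real k * h \<Longrightarrow> t \<le> s + real q * h \<Longrightarrow>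
      norm (z t - z s) < 1 / (real CARD('n) + 1)"
    and q: "0 < q" and out: "\<And>s. 0 \<le> s \<Longrightarrow> s \<le> real k * h \<Longrightarrow> 1 \<le> norm (z s)"
  shows "switch_count cyc y h k \<le> (k div q + 1) * p"
proof -
  have block: "switch_count cyc y h b \<le> switch_count cyc y h a + p"
    if ab: "a \<le> b" "b \<le> a + q" "b \<le> k" for a b
  proof (rule ccontr)
    assume many: "\<not> ?thesis"
    have zero: "\<exists>s\<in>{real a * h..real b * h}. z s $ j = 0" for j
    proof -
      obtain l where l: "l < p" "cyc (Suc (switch_count cyc y h a) + l) = j" using cycle by blast
      obtain i where i: "a \<le> i" "i < b" "switch_count cyc y h i = switch_count cyc y h a + l"
        "switch_count cyc y h (Suc i) = Suc (switch_count cyc y h a + l)"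
        using switch_occurs[of h a "switch_count cyc y h a + l" b] l many ab by auto
      then have "y (real i * h) $ j < y (real (Suc i) * h) $ j"
        using l(2) by (auto split: if_splits)
      then obtain s where s: "s \<in> {real i * h..real (Suc i) * h}" "z s $ j = 0"
        using complementary[of "real i * h" "real (Suc i) * h" j] h by (auto simp: mult_right_mono)
      moreover have "real a * h \<le> real i * h" "real (Suc i) * h \<le> real b * h"
        using i h by (auto intro!: mult_right_mono simp del: of_nat_Suc)
      ultimately show ?thesis by (intro bexI[of _ s]) auto
    qed
    have bk: "real b * h \<le> real k * h" using ab h by (intro mult_right_mono) auto
    have comp: "\<bar>z (real b * h) $ j\<bar> \<le> 1 / (real CARD('n) + 1)" for j
    proof -
      obtain s where s: "s \<in> {real a * h..real b * h}" "z s $ j = 0" using zero by blast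
      have "real b * h \<le> real (a + q) * h" using ab h by (intro mult_right_mono) auto
      then have "real b * h \<le> s + real q * h" using s by (simp add: algebra_simps)
      moreover have "0 \<le> real a * h" using h by simp
      ultimately have "norm (z (real b * h) - z s) < 1 / (real CARD('n) + 1)"
        using s bk by (intro osc) auto
      then show ?thesis
        using component_le_norm_cart[of "z (real b * h) - z s" j] s by simp
    qed
    have "norm (z (real b * h)) \<le> (\<Sum>j\<in>UNIV. \<bar>z (real b * h) $ j\<bar>)" by (rule norm_le_l1_cart)
    also have "\<dots> \<le> real CARD('n) * (1 / (real CARD('n) + 1))"
      using comp by (intro sum_bounded_above) 
    also have "\<dots> < 1" by (simp add: field_simps)
    finally show False using out[of "real b * h"] bk h by simp
  qed
  have "l \<le> k \<Longrightarrow> switch_count cyc y h l \<le> (l div q + 1) * p" for l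
  proof (induction l rule: less_induct)
    case (less l)
    show ?case
    proof (cases "l < q")
      case True
      then show ?thesis using block[of 0 l] less.prems by simp
    next
      case False
      then have "switch_count cyc y h (l - q) \<le> ((l - q) div q + 1) * p"
        using less q by auto
      moreover have "l div q = (l - q) div q + 1" using False q by (simp add: le_div_geq)
      ultimately show ?thesis using block[of "l - q" l] False less.prems by simp
    qed
  qed
  then show ?thesis by simp
qed

text \<open>A path that hits the unit ball ends with a small value of the active functional, although it
  starts with at least \<open>2 U + 2\<close>. On a fine grid switching errors amount to at most \<open>1\<close>, so the
  martingale part has to make up for the rest of the loss. The horizon of \<open>m * m\<close> steps of length
  \<open>1 / m\<close> eventually exceeds each hitting time.\<close>
lemma transform_eventually_negative:
  assumes \<tau>: "0 \<le> \<tau>" "norm (z \<tau>) < 1" and U: "\<And>j. norm (g j) \<le> U"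
    and start: "2 * U + 2 \<le> g (cyc 0) \<bullet> z 0"
  shows "\<forall>\<^sub>F m in sequentially.
    (\<Sum>k<m * m. indicator {k. \<forall>s\<in>{0..real k * (1 / real m)}. 1 \<le> norm (z s)} k *
      (active (1 / real m) k \<bullet> (w (real (Suc k) * (1 / real m)) - w (real k * (1 / real m))))) \<le> (-1::real)"
proof -
  define D where "D = (\<Sum>i\<in>UNIV. \<Sum>j\<in>UNIV. \<bar>g i \<bullet> column j R\<bar>)"
  have D: "- D \<le> g i \<bullet> column j R" "0 \<le> D" for i j
  proof -
    have "\<bar>g i \<bullet> column j R\<bar> \<le> (\<Sum>j\<in>UNIV. \<bar>g i \<bullet> column j R\<bar>)"
      by (rule member_le_sum) auto
    also have "\<dots> \<le> D" unfolding D_def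
      by (rule member_le_sum[where f = "\<lambda>i. \<Sum>j\<in>UNIV. \<bar>g i \<bullet> column j R\<bar>"]) (auto intro: sum_nonneg)
    finally show "- D \<le> g i \<bullet> column j R" "0 \<le> D" by auto
  qed
  have U0: "0 \<le> U" using U order_trans[OF norm_ge_zero] by blast
  have gU: "g j \<bullet> v \<le> U * norm v" for j v
    using norm_cauchy_schwarz[of "g j" v] mult_right_mono[OF U[of j], of "norm v"] by simp
  define T where "T = \<tau> + 1"
  have uni: "\<exists>d>0. \<forall>s\<in>{0..T}. \<forall>t\<in>{0..T}. \<bar>t - s\<bar> < d \<longrightarrow> norm (f t - f s) < e"
    if "continuous_on {0..} f" "0 < e" for f :: "real \<Rightarrow> real^'n" and e
  proof -
    have "continuous_on {0..T} f" by (rule continuous_on_subset[OF that(1)]) auto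
    then have "uniformly_continuous_on {0..T} f" by (rule compact_uniformly_continuous) simp
    then show ?thesis using that(2) by (auto simp: uniformly_continuous_on_def dist_norm)
  qed
  obtain \<eta> where \<eta>: "0 < \<eta>" and \<eta>z: "\<And>s t. s \<in> {0..T} \<Longrightarrow> t \<in> {0..T} \<Longrightarrow> \<bar>t - s\<bar> < \<eta> \<Longrightarrow>
      norm (z t - z s) < 1 / (real CARD('n) + 1)"
    using uni[OF cont_z, of "1 / (real CARD('n) + 1)"] by auto
  \<comment> \<open>A bound on the number of switches for each fine grid: blocks have length at least \<open>\<eta> / 4\<close>, and
    the last step may add one more switch.\<close>
  define Q where "Q = (4 * \<tau> / \<eta> + 1) * real p + 1"
  have Q: "0 \<le> Q" using \<tau> \<eta> by (simp add: Q_def)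
  define \<mu> where "\<mu> = 1 / (Q * (V + D) + 1)"
  have QVD: "0 \<le> Q * (V + D)" using Q V_nonneg D(2) by simp
  then have \<mu>: "0 < \<mu>" "\<mu> \<le> 1" "Q * ((V + D) * \<mu>) \<le> 1" by (auto simp: \<mu>_def field_simps)
  obtain \<zeta>1 where \<zeta>1: "0 < \<zeta>1" "\<And>s t. s \<in> {0..T} \<Longrightarrow> t \<in> {0..T} \<Longrightarrow> \<bar>t - s\<bar> < \<zeta>1 \<Longrightarrow> norm (z t - z s) < \<mu>"
    using uni[OF cont_z \<mu>(1)] by auto
  obtain \<zeta>2 where \<zeta>2: "0 < \<zeta>2" "\<And>s t. s \<in> {0..T} \<Longrightarrow> t \<in> {0..T} \<Longrightarrow> \<bar>t - s\<bar> < \<zeta>2 \<Longrightarrow> norm (y t - y s) < \<mu>"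
    using uni[OF cont_y \<mu>(1)] by auto
  have ev: "\<forall>\<^sub>F m in sequentially. c \<le> real m" for c :: real
    using filterlim_real_sequentially by (simp add: filterlim_at_top)
  have "\<forall>\<^sub>F m in sequentially. 8 / \<eta> \<le> real m \<and> 2 / \<zeta>1 \<le> real m \<and> 2 / \<zeta>2 \<le> real m \<and> T \<le> real m"
    by (intro eventually_conj ev)
  then show ?thesis
  proof eventually_elim
    case (elim m)
    define h where "h = 1 / real m"
    have m: "1 \<le> real m" using elim \<tau> by (simp add: T_def)
    then have h: "0 < h" "h \<le> 1" "real m * h = 1" by (auto simp: h_def)
    have h\<zeta>: "h < \<zeta>1" "h < \<zeta>2"
      using elim m \<zeta>1(1) \<zeta>2(1) by (auto simp: h_def field_simps)
    define alive where "alive = {k. \<forall>s\<in>{0..real k * h}. 1 \<le> norm (z s)}"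
    define k1 where "k1 = nat \<lceil>\<tau> * real m\<rceil>"
    have k1: "\<tau> * real m \<le> real k1" "real k1 \<le> \<tau> * real m + 1"
      using \<tau> m by (auto simp: k1_def)
    have "\<tau> \<le> real k1 * h" using k1 m by (simp add: h_def field_simps)
    then have "k1 \<notin> alive" using \<tau> by (auto simp: alive_def not_le)
    \<comment> \<open>First grid time by which the ball has been visited.\<close>
    define K where "K = (LEAST k. k \<notin> alive)"
    have K: "K \<notin> alive" "K \<le> k1"
      unfolding K_def by (rule LeastI[of "\<lambda>k. k \<notin> alive"], fact) (rule Least_le, fact)
    have below: "k \<in> alive" if "k < K" for k
      using not_less_Least[of k "\<lambda>k. k \<notin> alive"] that by (auto simp: K_def)
    have above: "k \<notin> alive" if "K \<le> k" for k
    proof -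
      have "real K * h \<le> real k * h" using that h by (intro mult_right_mono) auto
      then show ?thesis using K(1) unfolding alive_def by fastforce
    qed
    have Kh: "real K * h \<le> T"
    proof -
      have "real K * h \<le> (\<tau> * real m + 1) * h" using K(2) k1(2) h by (intro mult_right_mono) auto
      also have "\<dots> = \<tau> + h" using h(3) by (simp add: algebra_simps)
      finally show ?thesis using h by (simp add: T_def)
    qed
    have "1 \<le> norm (z 0)"
    proof (rule ccontr)
      assume "\<not> ?thesis"
      then have "U * norm (z 0) \<le> U * 1" using U0 by (intro mult_left_mono) auto
      then show False using start gU[of "cyc 0" "z 0"] U0 by simp
    qed
    then have "0 \<in> alive" by (simp add: alive_def)
    then have "K \<noteq> 0" using K(1) by metis
    then obtain k where k: "K = Suc k" by (cases K) auto
    have k_alive: "1 \<le> norm (z s)" if "0 \<le> s" "s \<le> real k * h" for s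
      using below[of k] k that by (auto simp: alive_def)
    have k\<tau>: "real k * h < \<tau>" using k_alive[of \<tau>] \<tau> by (auto simp: not_le[symmetric])
    \<comment> \<open>Number of grid steps in a block of length close to \<open>\<eta> / 2\<close>.\<close>
    define q where "q = nat \<lfloor>\<eta> * real m / 2\<rfloor>"
    have \<eta>m: "8 \<le> \<eta> * real m" using elim \<eta> by (simp add: field_simps)
    then have q: "real q \<le> \<eta> * real m / 2" "\<eta> * real m / 4 \<le> real q"
      unfolding q_def by linarith+
    then have "0 < q" using \<eta>m by linarith
    have qh: "real q * h < \<eta>"
    proof -
      have "real q * h \<le> \<eta> * real m / 2 * h" using q h by (intro mult_right_mono) auto
      also have "\<dots> = \<eta> / 2" using h(3) by (simp add: algebra_simps)
      finally show ?thesis using \<eta> by simp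
    qed
    have "switch_count cyc y h k \<le> (k div q + 1) * p"
    proof (rule few_switches[OF h(1) _ \<open>0 < q\<close> k_alive])
      fix s t assume "0 \<le> s" "s \<le> t" "t \<le> real k * h" "t \<le> s + real q * h"
      then show "norm (z t - z s) < 1 / (real CARD('n) + 1)"
        using k\<tau> qh by (intro \<eta>z) (auto simp: T_def)
    qed
    moreover have "real (k div q) \<le> 4 * \<tau> / \<eta>"
    proof -
      have "real (k div q) * (\<eta> * real m / 4) \<le> real (k div q) * real q"
        using q by (intro mult_left_mono) auto
      also have "\<dots> \<le> real k" by (metis div_times_less_eq_dividend of_nat_le_iff of_nat_mult)
      also have "\<dots> \<le> \<tau> * real m" using k\<tau> m by (simp add: h_def field_simps)
      finally have "real (k div q) * (\<eta> / 4) \<le> \<tau>" using m by (simp add: field_simps)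
      then show ?thesis using \<eta> by (simp add: field_simps)
    qed
    ultimately have "real (switch_count cyc y h k) \<le> (4 * \<tau> / \<eta> + 1) * real p"
    proof -
      assume a: "switch_count cyc y h k \<le> (k div q + 1) * p" and b: "real (k div q) \<le> 4 * \<tau> / \<eta>"
      have "real (switch_count cyc y h k) \<le> (real (k div q) + 1) * real p"
        using a by (metis of_nat_1 of_nat_add of_nat_le_iff of_nat_mult)
      also have "\<dots> \<le> (4 * \<tau> / \<eta> + 1) * real p" using b by (intro mult_right_mono) auto
      finally show ?thesis .
    qed
    then have "real (switch_count cyc y h K) \<le> Q"
      using switch_count_Suc(2)[of h k] unfolding k Q_def by linarith
    then have err: "real (switch_count cyc y h K) * ((V + D) * \<mu>) \<le> 1"
      using \<mu> V_nonneg D(2) by (meson add_nonneg_nonneg mult_nonneg_nonneg mult_right_mono less_imp_le order_trans)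
    have sum: "g (cyc 0) \<bullet> z 0 + (\<Sum>k<K. active h k \<bullet> (w (real (Suc k) * h) - w (real k * h)))
        - real (switch_count cyc y h K) * ((V + D) * \<mu>) \<le> active h K \<bullet> z (real K * h)"
    proof (rule active_sum[OF h(1) D less_imp_le[OF \<mu>(1)]])
      fix s t assume "0 \<le> s" "s \<le> t" "t \<le> real K * h" "t \<le> s + h"
      then show "norm (z t - z s) \<le> \<mu> \<and> norm (y t - y s) \<le> \<mu>"
        using h\<zeta> Kh by (intro conjI less_imp_le[OF \<zeta>1(2)] less_imp_le[OF \<zeta>2(2)]) auto
    qed
    obtain s where s: "0 \<le> s" "s \<le> real K * h" "norm (z s) < 1"
      using K(1) by (auto simp: alive_def not_le)
    then have "real k * h < s" using k_alive[of s] by (auto simp: not_le[symmetric])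
    then have "real K * h - s < h" by (simp add: k algebra_simps)
    then have "norm (z (real K * h) - z s) < \<mu>"
      using s Kh h\<zeta> by (intro \<zeta>1(2)) auto
    then have "norm (z (real K * h)) \<le> 2"
      using s(3) \<mu>(2) norm_triangle_sub[of "z (real K * h)" "z s"] by simp
    then have "active h K \<bullet> z (real K * h) \<le> 2 * U"
      using gU[of "cyc (switch_count cyc y h K)" "z (real K * h)"] mult_left_mono[OF _ U0] by fastforce
    then have le: "(\<Sum>k<K. active h k \<bullet> (w (real (Suc k) * h) - w (real k * h))) \<le> -1"
      using sum err start by linarith
    have "K \<le> m * m"
    proof -
      have "real K \<le> \<tau> * real m + 1" using K(2) k1(2) by linarith
      also have "\<dots> \<le> T * real m" using m by (simp add: T_def algebra_simps)
      also have "\<dots> \<le> real m * real m" using elim by (intro mult_right_mono) auto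
      finally show ?thesis by (metis of_nat_le_iff of_nat_mult)
    qed
    then have "(\<Sum>k<m * m. indicator alive k * (active h k \<bullet> (w (real (Suc k) * h) - w (real k * h))))
        = (\<Sum>k<K. indicator alive k * (active h k \<bullet> (w (real (Suc k) * h) - w (real k * h))))"
      using above by (intro sum.mono_neutral_right) auto
    also have "\<dots> = (\<Sum>k<K. active h k \<bullet> (w (real (Suc k) * h) - w (real k * h)))"
      using below by (intro sum.cong) auto
    finally show ?case using le by (simp only: alive_def h_def)
  qed
qed

end

section \<open>The contradiction with a finite mean hitting time\<close>

text \<open>Boundedness of the second moments yields uniform integrability: on the event that the variable
  exceeds \<open>-1\<close>, whose probability tends to zero, it contributes little to the mean, which could
  then not stay at zero.\<close>
lemma (in prob_space) mean_zero_not_eventually_negative: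
  fixes N :: "nat \<Rightarrow> 'a \<Rightarrow> real"
  assumes meas: "\<And>m. N m \<in> borel_measurable M"
    and sq: "\<And>m. integrable M (\<lambda>\<omega>. (N m \<omega>)\<^sup>2)"
    and mean: "\<And>m. (\<integral>\<omega>. N m \<omega> \<partial>M) = 0"
    and bound: "\<And>m. (\<integral>\<omega>. (N m \<omega>)\<^sup>2 \<partial>M) \<le> C"
    and neg: "AE \<omega> in M. \<forall>\<^sub>F m in sequentially. N m \<omega> \<le> -1"
  shows False
proof -
  define b where "b = (\<lambda>m \<omega>. if N m \<omega> \<le> -1 then 0 else 1 :: real)"
  have b_meas: "b m \<in> borel_measurable M" for m
    unfolding b_def using meas[of m] by measurable
  have "(\<lambda>m. \<integral>\<omega>. b m \<omega> \<partial>M) \<longlonglongrightarrow> (\<integral>\<omega>. 0 \<partial>M)"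
  proof (rule integral_dominated_convergence[where w = "\<lambda>_. 1"])
    show "AE \<omega> in M. (\<lambda>m. b m \<omega>) \<longlonglongrightarrow> 0"
      using neg
    proof eventually_elim
      case (elim \<omega>)
      then have "\<forall>\<^sub>F m in sequentially. b m \<omega> = 0" by eventually_elim (simp add: b_def)
      then show ?case by (rule tendsto_eventually)
    qed
  qed (use b_meas in simp_all, simp add: b_def)
  then have lim: "(\<lambda>m. \<integral>\<omega>. b m \<omega> \<partial>M) \<longlonglongrightarrow> 0" by simp
  have C: "0 \<le> C" using bound[of 0] by (rule order_trans[rotated]) simp
  have "1 / (C + 1) \<le> (\<integral>\<omega>. b m \<omega> \<partial>M)" for m
  proof -
    have int_b: "integrable M (b m)"
      by (rule Bochner_Integration.integrable_bound[of _ "\<lambda>_. 1::real"]) (use b_meas in simp_all, simp add: b_def)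
    have int_N: "integrable M (N m)"
    proof (rule Bochner_Integration.integrable_bound)
      show "integrable M (\<lambda>\<omega>. 1 + (N m \<omega>)\<^sup>2)" using sq[of m] by simp
      have "\<bar>a\<bar> \<le> 1 + a\<^sup>2" for a :: real
        using sum_squares_bound[of "\<bar>a\<bar>" 1] by simp
      then show "AE \<omega> in M. norm (N m \<omega>) \<le> norm (1 + (N m \<omega>)\<^sup>2)" by simp
    qed (rule meas)
    have pt: "(C + 1) * (2 * N m \<omega> + 2) \<le> (N m \<omega>)\<^sup>2 + 2 * N m \<omega> + 1 + (C + 1)\<^sup>2 * b m \<omega>" for \<omega>
    proof (cases "N m \<omega> \<le> -1")
      case True
      then have "(C + 1) * (2 * N m \<omega> + 2) \<le> 0" using C by (intro mult_nonneg_nonpos) auto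
      moreover have "0 \<le> (N m \<omega> + 1)\<^sup>2" by simp
      ultimately show ?thesis using True by (simp add: b_def power2_eq_square algebra_simps)
    next
      case False
      have "0 \<le> (N m \<omega> + 1 - (C + 1))\<^sup>2" by simp
      then show ?thesis using False by (simp add: b_def power2_eq_square algebra_simps)
    qed
    have "(C + 1) * 2 = (\<integral>\<omega>. (C + 1) * (2 * N m \<omega> + 2) \<partial>M)"
      using int_N by (simp add: mean prob_space)
    also have "\<dots> \<le> (\<integral>\<omega>. (N m \<omega>)\<^sup>2 + 2 * N m \<omega> + 1 + (C + 1)\<^sup>2 * b m \<omega> \<partial>M)"
      by (rule integral_mono[OF _ _ pt]) (use int_N int_b sq in auto)
    also have "\<dots> = (\<integral>\<omega>. (N m \<omega>)\<^sup>2 \<partial>M) + 1 + (C + 1)\<^sup>2 * (\<integral>\<omega>. b m \<omega> \<partial>M)"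
      using int_N int_b sq[of m] by (simp add: mean prob_space)
    finally have "(C + 1) * 1 \<le> (C + 1) * ((C + 1) * (\<integral>\<omega>. b m \<omega> \<partial>M))"
      using bound[of m] by (simp add: power2_eq_square algebra_simps)
    then have "1 \<le> (C + 1) * (\<integral>\<omega>. b m \<omega> \<partial>M)"
      by (rule mult_left_le_imp_le) (use C in simp)
    then show ?thesis using C by (simp add: divide_le_eq mult.commute)
  qed
  then have "1 / (C + 1) \<le> 0" by (intro LIMSEQ_le_const[OF lim]) auto
  then show False using C by (simp add: divide_le_0_iff)
qed

text \<open>Makes the event of not having visited the open unit ball measurable.\<close>
lemma norm_ge_1_iff_at_rationals:
  fixes z :: "real \<Rightarrow> 'b::real_normed_vector"
  assumes cont: "continuous_on {0..} z"
  shows "(\<forall>s\<in>{0..t}. 1 \<le> norm (z s)) \<longleftrightarrow> (\<forall>s\<in>{0..t} \<inter> \<rat>. 1 \<le> norm (z s))"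
proof (intro iffI ballI)
  fix s assume rat: "\<forall>s\<in>{0..t} \<inter> \<rat>. 1 \<le> norm (z s)" and s: "s \<in> {0..t}"
  show "1 \<le> norm (z s)"
  proof (cases "s = 0")
    case False
    show ?thesis
    proof (rule ccontr)
      assume "\<not> 1 \<le> norm (z s)"
      then have "0 < 1 - norm (z s)" by simp
      then obtain d where d: "0 < d" "\<And>s'. 0 \<le> s' \<Longrightarrow> dist s' s < d \<Longrightarrow> dist (z s') (z s) < 1 - norm (z s)"
        using cont s unfolding continuous_on_iff by (metis atLeastAtMost_iff atLeast_iff)
      have "max 0 (s - d) < s" using False s d by auto
      then obtain r where r: "r \<in> \<rat>" "max 0 (s - d) < r" "r < s" using Rats_dense_in_real by blast
      then have "norm (z r - z s) < 1 - norm (z s)"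
        using d(2)[of r] by (simp add: dist_norm)
      moreover have "1 \<le> norm (z r)" using rat r s by auto
      ultimately show False using norm_triangle_sub[of "z r" "z s"] by simp
    qed
  qed (use rat s in auto)
qed auto

lemma switch_count_measurable:
  fixes Y :: "real \<Rightarrow> 'a \<Rightarrow> real^'n"
  assumes mono: "\<And>s t. s \<le> t \<Longrightarrow> subalgebra (F t) (F s :: 'a measure)"
    and Y: "adapted F Y" and h: "0 < h"
  shows "(\<lambda>\<omega>. switch_count cyc (\<lambda>t. Y t \<omega>) h k) \<in> measurable (F (real k * h)) (count_space UNIV)"
proof (induction k)
  case (Suc k)
  let ?c = "\<lambda>\<omega>. switch_count cyc (\<lambda>t. Y t \<omega>) h k" and ?F = "F (real (Suc k) * h)"
  have le: "real k * h \<le> real (Suc k) * h" using h by (intro mult_right_mono) auto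
  have c: "?c \<in> measurable ?F (count_space UNIV)" by (rule measurable_from_subalg[OF mono[OF le] Suc])
  have comp: "(\<lambda>\<omega>. Y t \<omega> $ j) \<in> borel_measurable ?F" if "0 \<le> t" "t \<le> real (Suc k) * h" for t j
    by (rule measurable_compose[OF measurable_from_subalg[OF mono[OF that(2)]]])
       (use Y that in \<open>auto simp: adapted_def intro!: borel_measurable_continuous_onI continuous_intros\<close>)
  have "(\<lambda>\<omega>. if Y (real k * h) \<omega> $ cyc (Suc n) < Y (real (Suc k) * h) \<omega> $ cyc (Suc n) then Suc n else n)
      \<in> measurable ?F (count_space UNIV)" for n
  proof -
    have [measurable]: "(\<lambda>\<omega>. Y (real k * h) \<omega> $ cyc (Suc n)) \<in> borel_measurable ?F"
      "(\<lambda>\<omega>. Y (real (Suc k) * h) \<omega> $ cyc (Suc n)) \<in> borel_measurable ?F"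
      using h le by (auto intro!: comp simp del: of_nat_Suc)
    show ?thesis by measurable
  qed
  from measurable_compose_countable[OF this c] show ?case by simp
qed simp

text \<open>If the coordinate were nonzero on \<open>[a, b]\<close>, the integral in the complementarity condition
  would be at least the Stieltjes mass of \<open>(a, b]\<close>, which is the growth of \<open>y\<close>.\<close>
lemma pushing_only_at_zero:
  fixes y z :: "real \<Rightarrow> real^'n"
  assumes cont: "continuous_on {0..} y" and mono: "mono_on {0..} (\<lambda>t. y t $ j)"
    and compl: "(\<integral>\<^sup>+ s\<in>{0..}. indicator {s. z s $ j \<noteq> 0} s \<partial>interval_measure (\<lambda>s. y (max 0 s) $ j)) = 0"
    and ab: "0 \<le> a" "a \<le> b" "y a $ j < y b $ j"
  shows "\<exists>s\<in>{a..b}. z s $ j = 0"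
proof (rule ccontr)
  assume none: "\<not> ?thesis"
  let ?F = "\<lambda>s. y (max 0 s) $ j"
  let ?\<mu> = "interval_measure ?F"
  have "continuous_on UNIV (y \<circ> max 0)"
    by (rule continuous_on_compose) (auto intro!: continuous_intros continuous_on_subset[OF cont])
  then have cont_F: "continuous_on UNIV ?F"
    by (auto intro!: continuous_intros simp: comp_def)
  have "emeasure ?\<mu> {a<..b} = ennreal (?F b - ?F a)"
  proof (rule emeasure_interval_measure_Ioc[OF ab(2)])
    show "?F s \<le> ?F t" if "s \<le> t" for s t
      using mono that by (auto simp: mono_on_def)
    show "continuous (at_right s) ?F" for s
      using cont_F by (simp add: continuous_on_eq_continuous_at continuous_at_imp_continuous_at_within)
  qed
  also have "\<dots> = ennreal (y b $ j - y a $ j)" using ab by simp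
  finally have "0 < emeasure ?\<mu> {a<..b}" using ab by simp
  also have "emeasure ?\<mu> {a<..b} = (\<integral>\<^sup>+ s. indicator {a<..b} s \<partial>?\<mu>)" by simp
  also have "\<dots> \<le> (\<integral>\<^sup>+ s\<in>{0..}. indicator {s. z s $ j \<noteq> 0} s \<partial>?\<mu>)"
    using none ab by (intro nn_integral_mono) (auto simp: indicator_def)
  finally show False using compl by simp
qed

lemma (in prob_space) AE_escapes_vanishing_sets:
  assumes "0 \<le> (e::real)" and "\<And>n. A n \<in> sets M" and "\<And>n. real n * prob (A n) \<le> e"
  shows "AE \<omega> in M. \<exists>n. \<omega> \<notin> A n"
proof -
  have meas: "(\<Inter>n. A n) \<in> sets M" using assms(2) by (intro sets.countable_INT) auto
  have "prob (\<Inter>n. A n) \<le> e * (1 / real (Suc n))" for n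
  proof -
    have "prob (\<Inter>n. A n) \<le> prob (A (Suc n))" using assms(2) by (intro finite_measure_mono) auto
    also have "\<dots> \<le> e * (1 / real (Suc n))"
      using assms(3)[of "Suc n"] by (simp add: field_simps)
    finally show ?thesis .
  qed
  moreover have "(\<lambda>n. e * (1 / real (Suc n))) \<longlonglongrightarrow> e * 0"
    by (intro tendsto_intros LIMSEQ_Suc[OF lim_1_over_n])
  ultimately have "prob (\<Inter>n. A n) \<le> e * 0"
    by (intro LIMSEQ_le_const[of _ "e * 0"]) auto
  then have "prob (\<Inter>n. A n) = 0" by (simp add: measure_le_0_iff)
  then have "AE \<omega> in M. \<omega> \<notin> (\<Inter>n. A n)"
    using meas by (intro AE_not_in) (simp add: null_sets_def emeasure_eq_measure)
  then show ?thesis by eventually_elim auto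
qed

text \<open>The neighbourhood of the origin that is not reached in finite mean time is the unit ball. With
  \<open>alive t\<close> the event of not having visited it up to time \<open>t\<close>, the time spent on the grid in these
  events is at most the hitting time, which bounds the second moments of the stopped transforms.\<close>
theorem switching_functionals_not_positive_recurrent:
  fixes P :: "real^'n \<Rightarrow> 'a measure"
  assumes \<Gamma>: "sym_pos_def \<Gamma>" and srbm: "srbm \<theta> \<Gamma> R M F P Z"
    and sw: "switching_functionals \<theta> R g cyc p V"
    and far: "\<And>K. \<exists>x\<in>nonneg_orthant. K \<le> g (cyc 0) \<bullet> x"
  shows "\<not> positive_recurrent P Z"
proof
  assume rec: "positive_recurrent P Z"
  define U where "U = (\<Sum>j\<in>UNIV. norm (g j))"
  have U: "norm (g j) \<le> U" for j unfolding U_def by (rule member_le_sum) auto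
  obtain x where x: "x \<in> nonneg_orthant" "2 * U + 2 \<le> g (cyc 0) \<bullet> x" using far by blast
  define Q where "Q = P x"
  define A where "A = (nonneg_orthant :: (real^'n) set) \<inter> ball 0 1"
  have "openin (top_of_set nonneg_orthant) A" unfolding A_def by (rule openin_open_Int) simp
  moreover have "0 \<in> A" by (simp add: A_def nonneg_orthant_def)
  ultimately have fin: "(\<integral>\<^sup>+ \<omega>. hitting_time Z A \<omega> \<partial>Q) < \<infinity>"
    using rec x(1) by (auto simp: positive_recurrent_def Q_def)
  define e where "e = enn2real (\<integral>\<^sup>+ \<omega>. hitting_time Z A \<omega> \<partial>Q)"
  have e: "0 \<le> e" "(\<integral>\<^sup>+ \<omega>. hitting_time Z A \<omega> \<partial>Q) = ennreal e" using fin by (auto simp: e_def)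
  from srbm have filt: "filtration (space M) F" and sub: "\<And>t. subalgebra M (F t)"
    and adZ: "adapted F Z" and contZ: "\<And>\<omega>. \<omega> \<in> space M \<Longrightarrow> continuous_on {0..} (\<lambda>t. Z t \<omega>)"
    and posZ: "\<And>\<omega> t. \<omega> \<in> space M \<Longrightarrow> 0 \<le> t \<Longrightarrow> Z t \<omega> \<in> nonneg_orthant"
    by (auto simp: srbm_def)
  from srbm x(1) obtain X Y where Q: "prob_space Q" "sets Q = sets M"
    and dec: "srbm_decomposition \<theta> \<Gamma> R F Q x Z X Y"
    unfolding srbm_def Q_def by blast
  have spQ: "space Q = space M" by (rule sets_eq_imp_space_eq[OF Q(2)])
  define W where "W = (\<lambda>t \<omega>. X t \<omega> - t *\<^sub>R \<theta>)"
  from dec have bm: "brownian_motion Q \<Gamma> x W" and mart: "vec_martingale Q F W" and adY: "adapted F Y"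
    by (auto simp: srbm_decomposition_def W_def)
  have subF: "subalgebra (F t) (F s)" if "s \<le> t" for s t
    using filtration.sets_F_mono[OF filt that] filtration.space_F[OF filt] by (simp add: subalgebra_def)
  interpret BM: brownian_martingale Q F W \<Gamma> x
  proof (intro brownian_martingale.intro brownian_martingale_axioms.intro Q(1) \<Gamma> bm mart)
    show "subalgebra Q (F t)" for t using sub[of t] Q(2) spQ by (simp add: subalgebra_def)
    show "s \<le> t \<Longrightarrow> sets (F s) \<subseteq> sets (F t)" for s t using subF by (simp add: subalgebra_def)
  qed

  define alive where "alive = (\<lambda>t. {\<omega>\<in>space M. \<forall>s\<in>{0..t}. 1 \<le> norm (Z s \<omega>)})"
  have alive_F: "alive t \<in> sets (F t)" for t
  proof -
    have meas: "(\<lambda>\<omega>. norm (Z s \<omega>)) \<in> borel_measurable (F t)" if "s \<in> {0..t} \<inter> \<rat>" for s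
      using measurable_from_subalg[OF subF, of s t "Z s" borel] adZ that by (auto simp: adapted_def)
    have "{\<omega>\<in>space (F t). \<forall>s\<in>{0..t} \<inter> \<rat>. 1 \<le> norm (Z s \<omega>)} \<in> sets (F t)"
    proof (rule sets.sets_Collect_countable_All')
      show "countable ({0..t} \<inter> \<rat>)" using countable_rat by (rule countable_subset[rotated]) auto
      show "{\<omega>\<in>space (F t). 1 \<le> norm (Z s \<omega>)} \<in> sets (F t)" if "s \<in> {0..t} \<inter> \<rat>" for s
        using meas[OF that] by measurable
    qed
    also have "{\<omega>\<in>space (F t). \<forall>s\<in>{0..t} \<inter> \<rat>. 1 \<le> norm (Z s \<omega>)} = alive t"
      unfolding alive_def filtration.space_F[OF filt] using norm_ge_1_iff_at_rationals[OF contZ] by blast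
    finally show ?thesis .
  qed
  then have alive_Q: "alive t \<in> sets Q" for t
    using BM.subalg by (auto simp: subalgebra_def)
  have hit: "ennreal t \<le> hitting_time Z A \<omega>" if "\<omega> \<in> alive t" for t \<omega>
    unfolding hitting_time_def
  proof (rule Inf_greatest, clarify)
    fix s assume s: "0 \<le> s" "Z s \<omega> \<in> A"
    have "s \<le> t \<Longrightarrow> 1 \<le> norm (Z s \<omega>)" using that s by (simp add: alive_def)
    then have "\<not> s \<le> t" using s by (auto simp: A_def)
    then show "ennreal t \<le> ennreal s" by (simp add: ennreal_leI)
  qed
  have occupation: "h * (\<Sum>k<n. BM.prob (alive (real (Suc k) * h))) \<le> e" if h: "0 < h" for h n
  proof -
    \<comment> \<open>Counting from step one keeps the sum below the hitting time; the step at time zero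
      adds at most \<open>h\<close> to the bound.\<close>
    have pt: "ennreal (h * (\<Sum>k<n. indicator (alive (real (Suc k) * h)) \<omega>)) \<le> hitting_time Z A \<omega>" for \<omega>
    proof (induction n)
      case (Suc n)
      show ?case
      proof (cases "\<omega> \<in> alive (real (Suc n) * h)")
        case True
        have "(\<Sum>k<Suc n. indicator (alive (real (Suc k) * h)) \<omega>) \<le> (\<Sum>k<Suc n. 1::real)"
          by (intro sum_mono) (auto simp: indicator_def)
        then have "h * (\<Sum>k<Suc n. indicator (alive (real (Suc k) * h)) \<omega>) \<le> h * (\<Sum>k<Suc n. 1::real)"
          using h by (intro mult_left_mono) auto
        then have "ennreal (h * (\<Sum>k<Suc n. indicator (alive (real (Suc k) * h)) \<omega>)) \<le> ennreal (real (Suc n) * h)"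
          by (intro ennreal_leI) (simp add: mult.commute)
        also have "\<dots> \<le> hitting_time Z A \<omega>" by (rule hit[OF True])
        finally show ?thesis .
      qed (use Suc in simp)
    qed simp
    have "h * (\<Sum>k<n. BM.prob (alive (real (Suc k) * h)))
        = (\<integral>\<omega>. h * (\<Sum>k<n. indicator (alive (real (Suc k) * h)) \<omega>) \<partial>Q)"
      using alive_Q by (subst integral_mult_right_zero, subst Bochner_Integration.integral_sum)
        (auto simp: BM.emeasure_eq_measure)
    then have "ennreal (h * (\<Sum>k<n. BM.prob (alive (real (Suc k) * h))))
        = (\<integral>\<^sup>+\<omega>. ennreal (h * (\<Sum>k<n. indicator (alive (real (Suc k) * h)) \<omega>)) \<partial>Q)"
      using alive_Q h
      by (subst nn_integral_eq_integral)
         (auto intro!: sum_nonneg mult_nonneg_nonneg AE_I2 simp: BM.emeasure_eq_measure)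
    also have "\<dots> \<le> ennreal e" unfolding e(2)[symmetric] by (intro nn_integral_mono pt)
    finally show ?thesis using e(1) by (simp add: ennreal_le_iff)
  qed
  have hits: "AE \<omega> in Q. \<exists>n. \<omega> \<notin> alive (real n)"
  proof (rule BM.AE_escapes_vanishing_sets[OF e(1) alive_Q])
    fix n show "real n * BM.prob (alive (real n)) \<le> e"
    proof (cases n)
      case (Suc n')
      then show ?thesis using occupation[of "real n" 1] by simp
    qed (use e in simp)
  qed
  from dec have dec_Z: "AE \<omega> in Q. \<forall>t\<ge>0. Z t \<omega> = X t \<omega> + R *v Y t \<omega>"
    and dec_cont: "AE \<omega> in Q. continuous_on {0..} (\<lambda>t. Y t \<omega>)"
    and dec_mono: "AE \<omega> in Q. \<forall>j. mono_on {0..} (\<lambda>t. Y t \<omega> $ j)"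
    and dec_0: "AE \<omega> in Q. Y 0 \<omega> = 0"
    and dec_compl: "AE \<omega> in Q. \<forall>j. (\<integral>\<^sup>+ s\<in>{0..}. indicator {s. Z s \<omega> $ j \<noteq> 0} s
        \<partial>interval_measure (\<lambda>s. Y (max 0 s) \<omega> $ j)) = 0"
    unfolding srbm_decomposition_def by - (elim conjE, assumption)+
  have start_x: "AE \<omega> in Q. W 0 \<omega> = x" using bm by (simp add: brownian_motion_def)
  have path: "AE \<omega> in Q. \<omega> \<in> space M \<and> (\<exists>\<tau>\<ge>0. norm (Z \<tau> \<omega>) < 1) \<and> Z 0 \<omega> = x \<and>
      switching_path \<theta> R g cyc p V (\<lambda>t. Z t \<omega>) (\<lambda>t. Y t \<omega>) (\<lambda>t. W t \<omega>)"
    using hits start_x dec_Z dec_cont dec_mono dec_0 dec_compl AE_space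
  proof eventually_elim
    case (elim \<omega>)
    have \<omega>: "\<omega> \<in> space M" using elim(8) spQ by simp
    have "\<exists>\<tau>\<ge>0. norm (Z \<tau> \<omega>) < 1" using elim(1) \<omega> by (auto simp: alive_def not_le)
    moreover have "Z 0 \<omega> = x" using elim(2,3,6) by (simp add: W_def)
    moreover have "switching_path \<theta> R g cyc p V (\<lambda>t. Z t \<omega>) (\<lambda>t. Y t \<omega>) (\<lambda>t. W t \<omega>)"
    proof (intro switching_path.intro switching_path_axioms.intro sw)
      show "0 \<le> t \<Longrightarrow> Z t \<omega> = W t \<omega> + t *\<^sub>R \<theta> + R *v Y t \<omega>" for t
        using elim(3) by (simp add: W_def)
      show "0 \<le> a \<Longrightarrow> a \<le> b \<Longrightarrow> Y a \<omega> $ j < Y b \<omega> $ j \<Longrightarrow> \<exists>s\<in>{a..b}. Z s \<omega> $ j = 0" for a b j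
        using pushing_only_at_zero[OF elim(4), of j "\<lambda>s. Z s \<omega>" a b] elim(5,7) by blast
    qed (use elim contZ[OF \<omega>] posZ[OF \<omega>] in auto)
    ultimately show ?case using \<omega> by blast
  qed

  obtain C where C: "0 \<le> C" and bounds: "\<forall>h>0. \<forall>K G B n.
      (\<forall>k i. (\<lambda>\<omega>. G k \<omega> $ i) \<in> borel_measurable (F (real k * h))) \<longrightarrow>
      (\<forall>k \<omega>. norm (G k \<omega>) \<le> K) \<longrightarrow> (\<forall>k. B k \<in> sets (F (real k * h))) \<longrightarrow>
      BM.transform B G h n \<in> borel_measurable (F (real n * h)) \<and>
      integrable Q (\<lambda>\<omega>. (BM.transform B G h n \<omega>)\<^sup>2) \<and>
      (\<integral>\<omega>. BM.transform B G h n \<omega> \<partial>Q) = 0 \<and>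
      (\<integral>\<omega>. (BM.transform B G h n \<omega>)\<^sup>2 \<partial>Q) \<le> C * K\<^sup>2 * h * (\<Sum>k<n. BM.prob (B k))"
    using BM.transform_bounds by (elim exE conjE)
  note bounds = bounds[rule_format]
  define G where "G = (\<lambda>h k \<omega>. g (cyc (switch_count cyc (\<lambda>t. Y t \<omega>) h k)))"
  define h where "h = (\<lambda>m. 1 / real (Suc m))"
  define N where "N = (\<lambda>m. BM.transform (\<lambda>k. alive (real k * h m)) (G (h m)) (h m) (Suc m * Suc m))"
  have h: "0 < h m" "h m \<le> 1" for m by (auto simp: h_def)
  have G_meas: "(\<lambda>\<omega>. G (h m) k \<omega> $ i) \<in> borel_measurable (F (real k * h m))" for m k i
    unfolding G_def
    by (rule measurable_compose[OF switch_count_measurable[OF subF adY h(1)]]) simp_all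
  show False
  proof (rule BM.mean_zero_not_eventually_negative[of N "C * U\<^sup>2 * (1 + e)"])
    have GU: "norm (G (h m) k \<omega>) \<le> U" for m k \<omega> unfolding G_def by (rule U)
    fix m
    have *: "N m \<in> borel_measurable (F (real (Suc m * Suc m) * h m)) \<and>
      integrable Q (\<lambda>\<omega>. (N m \<omega>)\<^sup>2) \<and> (\<integral>\<omega>. N m \<omega> \<partial>Q) = 0 \<and>
      (\<integral>\<omega>. (N m \<omega>)\<^sup>2 \<partial>Q) \<le> C * U\<^sup>2 * h m * (\<Sum>k<Suc m * Suc m. BM.prob (alive (real k * h m)))"
      unfolding N_def by (rule bounds[OF h(1) G_meas GU alive_F])
    then show "N m \<in> borel_measurable Q" "integrable Q (\<lambda>\<omega>. (N m \<omega>)\<^sup>2)" "(\<integral>\<omega>. N m \<omega> \<partial>Q) = 0"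
      by (auto intro: BM.measurable_from_F)
    from * have var: "(\<integral>\<omega>. (N m \<omega>)\<^sup>2 \<partial>Q) \<le> C * U\<^sup>2 * h m * (\<Sum>k<Suc m * Suc m. BM.prob (alive (real k * h m)))"
      by blast
    show "(\<integral>\<omega>. (N m \<omega>)\<^sup>2 \<partial>Q) \<le> C * U\<^sup>2 * (1 + e)"
    proof -
      define n where "n = Suc m * Suc m - 1"
      have n: "Suc m * Suc m = Suc n" by (simp add: n_def)
      have "h m * (\<Sum>k<Suc n. BM.prob (alive (real k * h m)))
          = h m * BM.prob (alive 0) + h m * (\<Sum>k<n. BM.prob (alive (real (Suc k) * h m)))"
        unfolding sum.lessThan_Suc_shift by (simp add: distrib_left)
      also have "\<dots> \<le> 1 * 1 + e"
        using h[of m] by (intro add_mono mult_mono occupation) auto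
      finally have "C * U\<^sup>2 * (h m * (\<Sum>k<Suc m * Suc m. BM.prob (alive (real k * h m)))) \<le> C * U\<^sup>2 * (1 + e)"
        using C unfolding n by (intro mult_left_mono) auto
      then show ?thesis using var by (simp only: mult.assoc)
    qed
  next
    show "AE \<omega> in Q. \<forall>\<^sub>F m in sequentially. N m \<omega> \<le> -1"
      using path
    proof eventually_elim
      case (elim \<omega>)
      then obtain \<tau> where \<tau>: "0 \<le> \<tau>" "norm (Z \<tau> \<omega>) < 1" by blast
      interpret switching_path \<theta> R g cyc p V "\<lambda>t. Z t \<omega>" "\<lambda>t. Y t \<omega>" "\<lambda>t. W t \<omega>"
        using elim by blast
      have start: "2 * U + 2 \<le> g (cyc 0) \<bullet> Z 0 \<omega>" using elim x by simp
      have ind: "indicator {k. \<forall>s\<in>{0..real k * t}. 1 \<le> norm (Z s \<omega>)} k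
          = (indicator (alive (real k * t)) \<omega> :: real)" for k t
        using elim by (simp add: alive_def indicator_def)
      from transform_eventually_negative[OF \<tau> U start, unfolded ind]
      have "\<forall>\<^sub>F m in sequentially. BM.transform (\<lambda>k. alive (real k * (1 / real m)))
          (G (1 / real m)) (1 / real m) (m * m) \<omega> \<le> -1"
        unfolding BM.transform_def G_def .
      then show ?case unfolding N_def h_def
        by (subst (asm) eventually_sequentially_Suc[symmetric])
    qed
  qed
qed

section \<open>Weights from the gain\<close>

text \<open>The functional \<open>g\<^sub>J = u - v\<^sub>J e\<^sub>J\<close> kills the drift by the choice \<open>v\<^sub>J = u \<bullet> \<theta> / \<theta>\<^sub>J\<close>. In these terms the
  weight condition reads \<open>u \<bullet> R\<^sup>j \<ge> v\<^sub>j\<close>, which settles \<open>j = J\<close>. For another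
  coordinate that does not follow \<open>J\<close>, the hypothesis on \<open>\<theta>\<close> gives \<open>v\<^sub>J R\<^sub>J\<^sub>j \<le> v\<^sub>j\<close>.\<close>
lemma weights_give_switching_functionals:
  fixes \<theta> u :: "real^'n" and R :: "real^'n^'n"
  assumes \<theta>: "\<And>j. \<theta> $ j < 0" and u: "\<And>j. 0 < u $ j" and R: "\<And>j. R $ j $ j = 1"
    and weights: "\<And>j. \<theta> $ j * (u \<bullet> column j R) \<le> u \<bullet> \<theta>"
    and cyc: "\<And>n j. j \<noteq> cyc n \<Longrightarrow> j \<noteq> cyc (Suc n) \<Longrightarrow> \<theta> $ cyc n \<le> \<theta> $ j * R $ cyc n $ j"
    and cycle: "\<And>n j. \<exists>l<p. cyc (n + l) = j"
  defines "v \<equiv> \<lambda>j. (u \<bullet> \<theta>) / \<theta> $ j"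
  shows "switching_functionals \<theta> R (\<lambda>j. u - v j *\<^sub>R axis j 1) cyc p (\<Sum>j\<in>UNIV. v j)"
proof
  have "u \<bullet> \<theta> \<le> 0"
    unfolding inner_vec_def using \<theta> u by (intro sum_nonpos) (simp add: less_imp_le mult_nonneg_nonpos)
  then have v: "0 \<le> v j" for j using \<theta>[of j] by (simp add: v_def divide_nonpos_neg)
  then show "0 \<le> (\<Sum>j\<in>UNIV. v j)" by (intro sum_nonneg)
  have v_eq: "v j * \<theta> $ j = u \<bullet> \<theta>" for j using \<theta>[of j] by (simp add: v_def)
  show "(u - v j *\<^sub>R axis j 1) \<bullet> \<theta> = 0" for j
    by (simp add: inner_diff_left inner_axis' v_eq)
  show "\<exists>l<p. cyc (n + l) = j" for n j by (rule cycle)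
  show "0 \<le> (u - v (cyc n) *\<^sub>R axis (cyc n) 1) \<bullet> column j R" if "j \<noteq> cyc (Suc n)" for j n
  proof -
    let ?J = "cyc n"
    have push: "v j \<le> u \<bullet> column j R"
      unfolding v_def using weights[of j] \<theta>[of j] by (simp add: neg_divide_le_eq mult.commute)
    have "v ?J * R $ ?J $ j \<le> v j"
    proof (cases "j = ?J")
      case False
      have "v ?J * (\<theta> $ j * R $ ?J $ j) \<ge> v ?J * \<theta> $ ?J"
        using cyc[OF False that] v by (intro mult_left_mono)
      then have "\<theta> $ j * v j \<le> \<theta> $ j * (v ?J * R $ ?J $ j)"
        using v_eq[of j] v_eq[of ?J] by (simp add: mult_ac)
      then show ?thesis using \<theta>[of j] by (simp add: mult_le_cancel_left_neg)
    qed (simp add: R)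
    then show ?thesis
      using push by (simp add: inner_diff_left inner_axis' column_def)
  qed
  fix z :: "real^'n" and n assume "z \<in> nonneg_orthant"
  then have z: "0 \<le> z $ j" for j by (simp add: nonneg_orthant_def)
  have "v (cyc (Suc n)) \<le> (\<Sum>j\<in>UNIV. v j)" using v by (intro member_le_sum) auto
  then have "v (cyc (Suc n)) * z $ cyc (Suc n) \<le> (\<Sum>j\<in>UNIV. v j) * z $ cyc (Suc n)"
    using z by (intro mult_right_mono)
  moreover have "0 \<le> v (cyc n) * z $ cyc n" using v z by simp
  ultimately show "(u - v (cyc n) *\<^sub>R axis (cyc n) 1) \<bullet> z - (\<Sum>j\<in>UNIV. v j) * z $ cyc (Suc n)
      \<le> (u - v (cyc (Suc n)) *\<^sub>R axis (cyc (Suc n)) 1) \<bullet> z"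
    by (simp add: inner_diff_left inner_axis')
qed

text \<open>Suitable starting points lie far out on the axis of the coordinate \<open>cyc (Suc 0)\<close>, along which
  \<open>g (cyc 0)\<close> grows with slope \<open>u $ cyc (Suc 0)\<close>.\<close>
lemma weights_not_positive_recurrent:
  fixes \<theta> u :: "real^'n" and R \<Gamma> :: "real^'n^'n"
  assumes "sym_pos_def \<Gamma>" and "srbm \<theta> \<Gamma> R M F P Z"
    and \<theta>: "\<And>j. \<theta> $ j < 0" and u: "\<And>j. 0 < u $ j" and R: "\<And>j. R $ j $ j = 1"
    and weights: "\<And>j. \<theta> $ j * (u \<bullet> column j R) \<le> u \<bullet> \<theta>"
    and cyc: "\<And>n j. j \<noteq> cyc n \<Longrightarrow> j \<noteq> cyc (Suc n) \<Longrightarrow> \<theta> $ cyc n \<le> \<theta> $ j * R $ cyc n $ j"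
    and cycle: "\<And>n j. \<exists>l<p. cyc (n + l) = j" and moves: "cyc (Suc 0) \<noteq> cyc 0"
  shows "\<not> positive_recurrent P Z"
proof (rule switching_functionals_not_positive_recurrent[OF assms(1,2)
      weights_give_switching_functionals[OF \<theta> u R weights cyc cycle]])
  fix K :: real
  let ?j = "cyc (Suc 0)"
  define x where "x = (max 0 K / u $ ?j) *\<^sub>R (axis ?j 1 :: real^'n)"
  have "x \<in> nonneg_orthant"
    using u[of ?j] by (auto simp: x_def nonneg_orthant_def axis_def)
  moreover have "(u - (u \<bullet> \<theta> / \<theta> $ cyc 0) *\<^sub>R axis (cyc 0) 1) \<bullet> x = max 0 K"
  proof -
    have "axis (cyc 0) (1::real) $ ?j = 0" using moves by (simp add: axis_def)
    then show ?thesis using u[of ?j] by (simp add: x_def inner_diff_left inner_axis)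
  qed
  ultimately show "\<exists>x\<in>nonneg_orthant. K \<le> (u - (u \<bullet> \<theta> / \<theta> $ cyc 0) *\<^sub>R axis (cyc 0) 1) \<bullet> x"
    by (intro bexI[of _ x]) auto
qed

text \<open>With \<open>u\<^sub>1 = 1\<close>, the weights \<open>u\<^sub>2\<close> and \<open>u\<^sub>3\<close> are chosen such that the condition is an equality for
  the pushing directions \<open>3\<close> and \<open>2\<close>. The condition for direction \<open>1\<close> closes the cycle and amounts
  to a gain of at least one. On \<open>C2\<close> all six differences change sign; there a gain of at least one
  means \<open>beta1 \<theta> R \<le> 1\<close>, and this inequality is multiplied by a negative number.\<close>
lemma gain_weights:
  fixes \<theta> :: "real^3" and R :: "real^3^3"
  assumes C: "(\<theta>, R) \<in> C1 \<union> C2" and beta: "1 \<le> beta \<theta> R"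
    and R: "R $ 1 $ 1 = 1" "R $ 2 $ 2 = 1" "R $ 3 $ 3 = 1"
  shows "\<exists>u :: real^3. (\<forall>j. 0 < u $ j) \<and> (\<forall>j. \<theta> $ j * (u \<bullet> column j R) \<le> u \<bullet> \<theta>)"
proof -
  define p1 p2 p3 where p: "p1 = \<theta> $ 1 - \<theta> $ 2 * R $ 1 $ 2" "p2 = \<theta> $ 2 - \<theta> $ 3 * R $ 2 $ 3"
    "p3 = \<theta> $ 3 - \<theta> $ 1 * R $ 3 $ 1"
  define q1 q2 q3 where q: "q1 = \<theta> $ 3 * R $ 1 $ 3 - \<theta> $ 1" "q2 = \<theta> $ 1 * R $ 2 $ 1 - \<theta> $ 2"
    "q3 = \<theta> $ 2 * R $ 3 $ 2 - \<theta> $ 3"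
  have b1: "beta1 \<theta> R = (p1 / q3) * (p2 / q1) * (p3 / q2)" by (simp add: beta1_def p q)
  have signs: "(0 < p1 \<and> 0 < p2 \<and> 0 < p3 \<and> 0 < q1 \<and> 0 < q2 \<and> 0 < q3 \<and> 1 \<le> beta1 \<theta> R) \<or>
    (p1 < 0 \<and> p2 < 0 \<and> p3 < 0 \<and> q1 < 0 \<and> q2 < 0 \<and> q3 < 0 \<and> beta1 \<theta> R \<le> 1)"
  proof (cases "(\<theta>, R) \<in> C1")
    case True
    then show ?thesis using beta by (simp add: beta_def C1_def p q)
  next
    case False
    then have "(\<theta>, R) \<in> C2" using C by blast
    then have neg: "p1 < 0 \<and> p2 < 0 \<and> p3 < 0 \<and> q1 < 0 \<and> q2 < 0 \<and> q3 < 0"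
      by (simp add: C2_def p q)
    then have "0 < beta1 \<theta> R"
      unfolding b1 by (intro mult_pos_pos divide_neg_neg) auto
    then show ?thesis using False beta neg by (simp add: beta_def beta2_def)
  qed
  define u :: "real^3" where "u = vector [1, q1 / p2, p1 / q3]"
  have u: "u $ 1 = 1" "u $ 2 = q1 / p2" "u $ 3 = p1 / q3" by (simp_all add: u_def)
  have key: "u $ 2 * q2 \<le> u $ 3 * p3"
  proof -
    have eq: "u $ 3 * p3 = beta1 \<theta> R * (u $ 2 * q2)"
      using signs by (auto simp: b1 u)
    show ?thesis using signs
    proof
      assume s: "0 < p1 \<and> 0 < p2 \<and> 0 < p3 \<and> 0 < q1 \<and> 0 < q2 \<and> 0 < q3 \<and> 1 \<le> beta1 \<theta> R"
      then have "0 \<le> u $ 2 * q2" by (simp add: u)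
      then show ?thesis using s mult_right_mono[of 1 "beta1 \<theta> R" "u $ 2 * q2"] by (simp add: eq)
    next
      assume s: "p1 < 0 \<and> p2 < 0 \<and> p3 < 0 \<and> q1 < 0 \<and> q2 < 0 \<and> q3 < 0 \<and> beta1 \<theta> R \<le> 1"
      then have "0 \<le> q1 * q2" by (intro mult_nonpos_nonpos) auto
      then have "u $ 2 * q2 \<le> 0" using s by (simp add: u divide_nonneg_neg)
      then show ?thesis using s mult_right_mono_neg[of "beta1 \<theta> R" 1 "u $ 2 * q2"] by (simp add: eq)
    qed
  qed
  have "u $ 3 * q3 = u $ 1 * p1" "u $ 2 * p2 = u $ 1 * q1" using signs by (auto simp: u)
  with key have "\<theta> $ j * (u \<bullet> column j R) \<le> u \<bullet> \<theta>" for j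
    using exhaust_3[of j] R
    by (auto simp: inner_vec_def sum_3 column_def p q algebra_simps)
  moreover have "0 < u $ j" for j
    using exhaust_3[of j] signs by (auto simp: u divide_neg_neg)
  ultimately show ?thesis by blast
qed

text \<open>The two senses of rotation, written with the arithmetic of the three-element type modulo \<open>3\<close>,
  where \<open>3 = 0\<close>.\<close>
lemma cyclic_order_3:
  shows "\<exists>l<3. of_nat (n + l) = (j :: 3)" and "\<exists>l<3. - of_nat (n + l) = (j :: 3)"
proof -
  have ex: "\<exists>l<3. of_nat l = (i :: 3)" for i
    using exhaust_3[of i]
  proof (elim disjE)
    assume "i = 1" then show ?thesis by (intro exI[of _ 1]) simp
  next
    assume "i = 2" then show ?thesis by (intro exI[of _ 2]) simp
  next
    assume "i = 3" then show ?thesis by (intro exI[of _ 0]) simp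
  qed
  from ex[of "j - of_nat n"] show "\<exists>l<3. of_nat (n + l) = j"
    by (metis add_diff_cancel_left' add.commute diff_add_cancel of_nat_add)
  from ex[of "- j - of_nat n"] show "\<exists>l<3. - of_nat (n + l) = j"
    by (metis add.commute diff_add_cancel minus_minus of_nat_add)
qed

theorem theorem3:
  fixes \<theta> :: "real^3" and \<Gamma> R :: "real^3^3"
    and M :: "'a measure" and F :: "real \<Rightarrow> 'a measure"
    and P :: "real^3 \<Rightarrow> 'a measure" and Z :: "real \<Rightarrow> 'a \<Rightarrow> real^3"
  assumes "sym_pos_def \<Gamma>"
    and "completely_S R" and "R $ 1 $ 1 = 1" and "R $ 2 $ 2 = 1" and "R $ 3 $ 3 = 1"
    and "srbm \<theta> \<Gamma> R M F P Z"
    and "(\<theta>, R) \<in> C1 \<union> C2" and "beta \<theta> R \<ge> 1"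
  shows "\<not> positive_recurrent P Z"
proof -
  obtain u :: "real^3" where u: "\<And>j. 0 < u $ j" "\<And>j. \<theta> $ j * (u \<bullet> column j R) \<le> u \<bullet> \<theta>"
    using gain_weights[OF assms(7,8) assms(3-5)] by blast
  have \<theta>: "\<theta> $ j < 0" for j using assms(7) by (auto simp: C1_def C2_def)
  have R: "R $ j $ j = 1" for j using exhaust_3[of j] assms(3-5) by auto
  have suc: "(1::3) + 1 = 2" "(2::3) + 1 = 3" "(3::3) + 1 = 1" "(1::3) - 1 = 3" "(2::3) - 1 = 1" "(3::3) - 1 = 2"
    by simp_all
  show ?thesis
  proof (cases "(\<theta>, R) \<in> C1")
    case True
    have cyc: "\<theta> $ i \<le> \<theta> $ j * R $ i $ j" if "j \<noteq> i" "j \<noteq> i + 1" for i j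
      using exhaust_3[of i] exhaust_3[of j] that True suc by (auto simp: C1_def)
    show ?thesis
    proof (rule weights_not_positive_recurrent[OF assms(1,6) \<theta> u(1) R u(2), where cyc = of_nat and p = 3])
      show "\<theta> $ of_nat n \<le> \<theta> $ j * R $ of_nat n $ j"
        if "j \<noteq> of_nat n" "j \<noteq> of_nat (Suc n)" for n and j :: 3
        using that by (intro cyc) (auto simp: add.commute)
    qed (use cyclic_order_3(1) in auto)
  next
    case False
    then have "(\<theta>, R) \<in> C2" using assms(7) by blast
    then have cyc: "\<theta> $ i \<le> \<theta> $ j * R $ i $ j" if "j \<noteq> i" "j \<noteq> i - 1" for i j
      using exhaust_3[of i] exhaust_3[of j] that suc by (auto simp: C2_def)
    show ?thesis
    proof (rule weights_not_positive_recurrent[OF assms(1,6) \<theta> u(1) R u(2), where cyc = "\<lambda>n. - of_nat n" and p = 3])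
      show "\<theta> $ (- of_nat n) \<le> \<theta> $ j * R $ (- of_nat n) $ j"
        if "j \<noteq> - of_nat n" "j \<noteq> - of_nat (Suc n)" for n and j :: 3
      proof (rule cyc[OF that(1)])
        have "- of_nat (Suc n) = - of_nat n - (1::3)" by simp
        with that(2) show "j \<noteq> - of_nat n - 1" by (simp only: not_False_eq_True)
      qed
    qed (use cyclic_order_3(2) in auto)
  qed
qed

end
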